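(* Let $d\ge1$ and $1\le k\le d$ be integers, and for $x=(x_1,\dots,x_d)\in\mathbb{R}^d$ let $P_k(x):=(x_1,\dots,x_k,0,\dots,0)$ be the orthogonal projection onto the first $k$ coordinates. For $T>0$, let $\varphi^{k,\varepsilon}$ (for $\varepsilon>0$) and $\varphi^{k,0}$ be respectively the solutions of the viscous and first-order Hamilton-Jacobi equations with Hamiltonian $\frac12|p|^2$ (see context) with terminal data $g_k(x)=-|P_k(x)|$. Then for all $T>0$ and all $t\in[0,T)$, as $\varepsilon\to0^+$, $$\varphi^{k,\varepsilon}_t(0)=\varphi^{k,0}_t(0)+\frac{k-1}{2}\,\varepsilon\log\varepsilon-\frac{k-1}{2}\,\varepsilon\log(T-t)-\varepsilon\log\frac{k\sqrt\pi}{2^{\frac{k-1}{2}}\,\Gamma(\frac k2+1)}+o(\varepsilon),$$ where $\Gamma$ is the Gamma function.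
   Context: For $\varepsilon>0$, $\varphi^{k,\varepsilon}$ is the unique classical ($\mathcal{C}^{1,2}$ on $[0,T)\times\mathbb{R}^d$, continuous up to $t=T$) solution with bounded gradient of $$-\partial_t\varphi_t(x)+\frac12|\nabla\varphi_t(x)|^2=\frac\varepsilon2\Delta\varphi_t(x),\qquad \varphi_T=g_k,$$ and $\varphi^{k,0}$ is the unique Lipschitz-continuous viscosity solution of $$-\partial_t\varphi_t(x)+\frac12|\nabla\varphi_t(x)|^2=0,\qquad \varphi_T=g_k.$$ *)

theory Defs
  imports "HOL-Analysis.Analysis" "HOL-Library.Landau_Symbols"
begin

text \<open>
  The space is \<^typ>\<open>real^'n\<close> with \<^typ>\<open>'n\<close> finite and linearly ordered, the order giving the
  numbering $x_1, \dots, x_d$ of the coordinates. The coordinate \<open>x $ i\<close> is one of the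
  first \<open>k\<close> iff fewer than \<open>k\<close> indices precede \<open>i\<close>.
\<close>

definition proj_first :: "nat \<Rightarrow> real ^ 'n::{finite,linorder} \<Rightarrow> real ^ 'n::{finite,linorder}" where
  "proj_first k x = (\<chi> i. if card {j. j < i} < k then x $ i else 0)"

text \<open>
  A function $\varphi_t(x)$ on $[0,T] \times \mathbb{R}^d$ is a curried total function
  \<open>\<phi> t x\<close>; its values for \<open>t\<close> outside \<open>{0..T}\<close> are never used. The witnesses \<open>Dt\<close>, \<open>G\<close>, \<open>H\<close>
  are the time derivative (one-sided at \<open>t = 0\<close>), the spatial gradient and the
  spatial Hessian.
\<close>

definition viscous_HJ_classical_solution ::
  "real \<Rightarrow> real \<Rightarrow> (real ^ 'n \<Rightarrow> real) \<Rightarrow> (real \<Rightarrow> real ^ 'n \<Rightarrow> real) \<Rightarrow> bool" where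
  "viscous_HJ_classical_solution \<epsilon> T g \<phi> \<longleftrightarrow>
     continuous_on ({0..T} \<times> UNIV) (\<lambda>(t, x). \<phi> t x) \<and>
     (\<forall>x. \<phi> T x = g x) \<and>
     (\<exists>(Dt :: real \<Rightarrow> real ^ 'n \<Rightarrow> real) (G :: real \<Rightarrow> real ^ 'n \<Rightarrow> real ^ 'n)
        (H :: real \<Rightarrow> real ^ 'n \<Rightarrow> real ^ 'n ^ 'n).
        (\<forall>t\<in>{0..<T}. \<forall>x.
           ((\<lambda>s. \<phi> s x) has_real_derivative Dt t x) (at t within {0..<T}) \<and>
           (\<phi> t has_derivative (\<lambda>v. G t x \<bullet> v)) (at x) \<and>
           (G t has_derivative (\<lambda>v. H t x *v v)) (at x)) \<and>
        continuous_on ({0..<T} \<times> UNIV) (\<lambda>(t, x). Dt t x) \<and>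
        continuous_on ({0..<T} \<times> UNIV) (\<lambda>(t, x). G t x) \<and>
        continuous_on ({0..<T} \<times> UNIV) (\<lambda>(t, x). H t x) \<and>
        (\<exists>M. \<forall>t\<in>{0..<T}. \<forall>x. norm (G t x) \<le> M) \<and>
        (\<forall>t\<in>{0..<T}. \<forall>x. - Dt t x + 1 / 2 * (norm (G t x))\<^sup>2 = \<epsilon> / 2 * trace (H t x)))"

text \<open>\<open>\<psi>\<close> is continuously differentiable on $(0,T) \times \mathbb{R}^d$ with time derivative
  \<open>Dt\<close> and spatial gradient \<open>G\<close>.\<close>

definition C1_test_function ::
  "real \<Rightarrow> (real \<Rightarrow> real ^ 'n \<Rightarrow> real) \<Rightarrow> (real \<Rightarrow> real ^ 'n \<Rightarrow> real)
    \<Rightarrow> (real \<Rightarrow> real ^ 'n \<Rightarrow> real ^ 'n) \<Rightarrow> bool" where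
  "C1_test_function T \<psi> Dt G \<longleftrightarrow>
     (\<forall>t\<in>{0<..<T}. \<forall>x.
        ((\<lambda>(s, y). \<psi> s y) has_derivative (\<lambda>(h, v). Dt t x * h + G t x \<bullet> v)) (at (t, x))) \<and>
     continuous_on ({0<..<T} \<times> UNIV) (\<lambda>(t, x). Dt t x) \<and>
     continuous_on ({0<..<T} \<times> UNIV) (\<lambda>(t, x). G t x)"

definition HJ_viscosity_subsolution :: "real \<Rightarrow> (real \<Rightarrow> real ^ 'n \<Rightarrow> real) \<Rightarrow> bool" where
  "HJ_viscosity_subsolution T \<phi> \<longleftrightarrow>
     (\<forall>\<psi> Dt G. C1_test_function T \<psi> Dt G \<longrightarrow>
       (\<forall>t\<in>{0<..<T}. \<forall>x.
          (\<forall>\<^sub>F (s, y) in nhds (t, x). \<phi> s y - \<psi> s y \<le> \<phi> t x - \<psi> t x) \<longrightarrow>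
          - Dt t x + 1 / 2 * (norm (G t x))\<^sup>2 \<le> 0))"

definition HJ_viscosity_supersolution :: "real \<Rightarrow> (real \<Rightarrow> real ^ 'n \<Rightarrow> real) \<Rightarrow> bool" where
  "HJ_viscosity_supersolution T \<phi> \<longleftrightarrow>
     (\<forall>\<psi> Dt G. C1_test_function T \<psi> Dt G \<longrightarrow>
       (\<forall>t\<in>{0<..<T}. \<forall>x.
          (\<forall>\<^sub>F (s, y) in nhds (t, x). \<phi> s y - \<psi> s y \<ge> \<phi> t x - \<psi> t x) \<longrightarrow>
          - Dt t x + 1 / 2 * (norm (G t x))\<^sup>2 \<ge> 0))"

definition HJ_Lipschitz_viscosity_solution ::
  "real \<Rightarrow> (real ^ 'n \<Rightarrow> real) \<Rightarrow> (real \<Rightarrow> real ^ 'n \<Rightarrow> real) \<Rightarrow> bool" where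
  "HJ_Lipschitz_viscosity_solution T g \<phi> \<longleftrightarrow>
     (\<exists>L. L-lipschitz_on ({0..T} \<times> UNIV) (\<lambda>(t, x). \<phi> t x)) \<and>
     (\<forall>x. \<phi> T x = g x) \<and>
     HJ_viscosity_subsolution T \<phi> \<and> HJ_viscosity_supersolution T \<phi>"

end

theory Submission
  imports Defs "HOL-Real_Asymp.Real_Asymp"
begin

text \<open>
  The Cole-Hopf transform $u = e^{-\varphi/\varepsilon}$ turns the viscous equation into the backward
  heat equation with terminal value $e^{|P_k x|/\varepsilon}$. Since
  $2 \cosh y - 1 \le e^{y} \le 2 \cosh y$ for $y \ge 0$ and $\cosh |x|$ is a power series in $|x|^2$,
  whose heat flow is explicit in terms of heat polynomials, the maximum principle gives
  $2 F(s) - 1 \le u_t(0) \le 2 F(s)$ with $s = (T - t)/\varepsilon$ and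
  $F(s) = \sum_j 2^j (k/2)_j s^j / (2j)!$. Only finite truncations are compared: the tail of the
  $\cosh$ series is absorbed by the exponentially growing penalty of the maximum principle. The ratio
  $(k/2)_j / (1/2)_j \sim j^{(k-1)/2} \sqrt{\pi} / \Gamma(k/2)$ and an Abelian argument give the
  asymptotics of $F$ as $s \to \infty$.

  For the first-order equation, $\varphi^{k,0}_t(0) = -(T-t)/2$ follows by testing against perturbations
  of $-x_1 - (T-t)/2$, a solution above the terminal value, and of
  $-\sqrt{\delta^2 + |x|^2} - (T-t)/2$, a subsolution below it.
\<close>

section \<open>Asymptotics of the heat flow of the hyperbolic cosine\<close>

text \<open>The expansion of exp |y| contains odd powers of |y|, which are not polynomials in x and
  have no elementary heat flow; cosh keeps only the even ones, and the error, at most 1, is lost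
  against a quantity growing at least like exp (s / 2). This avoids any integral over R^k. The
  factors in the asymptotics of 2 F(s) are the terms of the theorem: with s = (T - t) / \<epsilon>,
  applying -\<epsilon> log turns exp (s / 2) into -(T - t) / 2, the power s^((k - 1) / 2) into the
  two logarithmic terms, the constant into the last term, and a relative error 1 + o(1) into
  o(\<epsilon>). Since the transformed solution may grow exponentially in x, the maximum principle
  needs a penalty of strictly larger exponential rate; the bounded gradient of the viscous solution
  supplies the rate to beat.\<close>

lemma abelian_ratio:
  fixes a b :: "nat \<Rightarrow> real"
  assumes b: "\<And>n. b n \<ge> 0" and pos: "\<And>n. n \<ge> 1 \<Longrightarrow> b n > 0"
    and sa: "\<And>z. summable (\<lambda>n. a n * z ^ n)" and sb: "\<And>z. summable (\<lambda>n. b n * z ^ n)"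
    and lim: "(\<lambda>n. a n / b n) \<longlonglongrightarrow> c"
  shows "((\<lambda>z. (\<Sum>n. a n * z ^ n) / (\<Sum>n. b n * z ^ n)) \<longlongrightarrow> c) at_top"
proof -
  \<comment> \<open>This single term has higher degree than the terms below \<open>N\<close> and
    eventually dominates their sum.\<close>
  have lead: "b (Suc N) * z ^ Suc N \<le> (\<Sum>n. b n * z ^ n)" if "z \<ge> 0" for z N
    using sum_le_suminf[OF sb, of "{Suc N}" z] b that by simp
  show ?thesis
  proof (rule tendstoI)
    fix e :: real assume e: "e > 0"
    have "\<forall>\<^sub>F n in sequentially. \<bar>a n / b n - c\<bar> < e / 2"
      using tendstoD[OF lim, of "e/2"] e by (simp add: dist_real_def)
    then obtain N0 where N0: "\<And>n. n \<ge> N0 \<Longrightarrow> \<bar>a n / b n - c\<bar> < e / 2"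
      by (auto simp: eventually_sequentially)
    \<comment> \<open>The shift by one makes every index from \<open>N\<close> on at least 1, where
      \<open>b\<close> is positive; \<open>b 0\<close> may vanish.\<close>
    define N where "N = Suc N0"
    define K where "K = (\<Sum>n<N. \<bar>a n - c * b n\<bar>)"
    have K0: "K \<ge> 0" by (simp add: K_def sum_nonneg)
    have tail: "\<bar>a n - c * b n\<bar> \<le> e / 2 * b n" if "n \<ge> N" for n
    proof -
      have bn: "b n > 0" using that N_def pos by simp
      have "a n - c * b n = (a n / b n - c) * b n" using bn by (simp add: field_simps)
      hence "\<bar>a n - c * b n\<bar> = \<bar>a n / b n - c\<bar> * b n" using bn by (simp add: abs_mult)
      also have "\<dots> \<le> e / 2 * b n"
        using N0[of n] that bn by (intro mult_right_mono) (auto simp: N_def)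
      finally show ?thesis .
    qed
    \<comment> \<open>Solves the requirement that \<open>K * z ^ N\<close> be less than
      \<open>e / 2\<close> times the term \<open>b (Suc N) * z ^ Suc N\<close>.\<close>
    define Z where "Z = max 1 (2 * K / (e * b (Suc N)) + 1)"
    have "dist ((\<Sum>n. a n * z ^ n) / (\<Sum>n. b n * z ^ n)) c < e" if zZ: "z \<ge> Z" for z
    proof -
      have z1: "z \<ge> 1" and z2: "z > 2 * K / (e * b (Suc N))"
        using zZ by (auto simp: Z_def)
      let ?B = "\<Sum>n. b n * z ^ n"
      have bp: "b (Suc N) > 0" by (simp add: pos)
      have Bl: "b (Suc N) * z ^ Suc N \<le> ?B" using lead z1 by simp
      have "0 < b (Suc N) * z ^ Suc N" using bp z1 by simp
      with Bl have Bpos: "?B > 0" by linarith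
      have d: "(a n - c * b n) * z ^ n = a n * z ^ n - c * (b n * z ^ n)" for n
        by (simp add: left_diff_distrib)
      have eqd: "(\<Sum>n. a n * z ^ n) - c * ?B = (\<Sum>n. (a n - c * b n) * z ^ n)"
        unfolding d suminf_mult[OF sb, symmetric]
        by (rule suminf_diff[OF sa summable_mult[OF sb]])
      have bd: "\<bar>(a n - c * b n) * z ^ n\<bar> \<le> (if n < N then \<bar>a n - c * b n\<bar> * z ^ N else 0) + e / 2 * (b n * z ^ n)" for n
      proof (cases "n < N")
        case True
        have "z ^ n \<le> z ^ N" using z1 True by (intro power_increasing) auto
        hence "\<bar>a n - c * b n\<bar> * z ^ n \<le> \<bar>a n - c * b n\<bar> * z ^ N" by (intro mult_left_mono) auto
        moreover have "0 \<le> e / 2 * (b n * z ^ n)" using e b z1 by simp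
        ultimately show ?thesis using True z1 by (simp add: abs_mult)
      next
        case False
        have "\<bar>a n - c * b n\<bar> * z ^ n \<le> e / 2 * b n * z ^ n"
          using tail[of n] False z1 by (intro mult_right_mono) auto
        then show ?thesis using False z1 by (simp add: abs_mult)
      qed
      have s1: "summable (\<lambda>n. if n < N then \<bar>a n - c * b n\<bar> * z ^ N else 0)"
        by (rule summable_finite[of "{..<N}"]) auto
      have s2: "summable (\<lambda>n. e / 2 * (b n * z ^ n))" by (intro summable_mult sb)
      have v1: "(\<Sum>n. if n < N then \<bar>a n - c * b n\<bar> * z ^ N else 0) = K * z ^ N"
        by (subst suminf_finite[of "{..<N}"]) (auto simp: K_def sum_distrib_right)
      have "summable (\<lambda>n. \<bar>(a n - c * b n) * z ^ n\<bar>)"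
        by (rule summable_comparison_test'[OF summable_add[OF s1 s2], of 0]) (use bd in auto)
      hence "\<bar>\<Sum>n. (a n - c * b n) * z ^ n\<bar> \<le> (\<Sum>n. \<bar>(a n - c * b n) * z ^ n\<bar>)"
        by (rule summable_rabs)
      also have "\<dots> \<le> (\<Sum>n. (if n < N then \<bar>a n - c * b n\<bar> * z ^ N else 0) + e / 2 * (b n * z ^ n))"
        by (intro suminf_le bd summable_add s1 s2) fact
      also have "\<dots> = K * z ^ N + e / 2 * ?B"
        using suminf_add[OF s1 s2] v1 suminf_mult[OF sb[of z], of "e/2"] by simp
      also have "\<dots> < e * ?B"
      proof -
        have "2 * K < e * b (Suc N) * z" using z2 bp e by (simp add: field_simps)
        hence "2 * K * z ^ N < e * b (Suc N) * z * z ^ N" using z1 by (intro mult_strict_right_mono) auto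
        also have "\<dots> = e * (b (Suc N) * z ^ Suc N)" by simp
        also have "\<dots> \<le> e * ?B" using Bl e by (intro mult_left_mono) auto
        finally show ?thesis by simp
      qed
      finally have "\<bar>(\<Sum>n. a n * z ^ n) - c * ?B\<bar> < e * ?B" using eqd by simp
      moreover have "(\<Sum>n. a n * z ^ n) / ?B - c = ((\<Sum>n. a n * z ^ n) - c * ?B) / ?B"
        using Bpos by (simp add: field_simps)
      ultimately show ?thesis using Bpos by (simp add: dist_real_def abs_divide pos_divide_less_eq)
    qed
    then show "\<forall>\<^sub>F z in at_top. dist ((\<Sum>n. a n * z ^ n) / (\<Sum>n. b n * z ^ n)) c < e"
      by (auto simp: eventually_at_top_linorder)
  qed
qed

text \<open>Comparison series for the Abelian argument, expected to grow like
  \<open>z powr \<alpha> * exp z\<close>. As \<open>0 powr \<alpha> = 0\<close> even for \<alpha> =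
  0, the constant term is always absent.\<close>

definition powr_exp_series :: "real \<Rightarrow> real \<Rightarrow> real" where
  "powr_exp_series \<alpha> z = (\<Sum>n. real n powr \<alpha> / fact n * z ^ n)"

lemma summable_powr_exp_series: "summable (\<lambda>n. real n powr \<alpha> / fact n * z ^ n)" 
proof -
  have *: "summable (\<lambda>n. norm (real n ^ m / fact n * z ^ n))" for m
  proof (induction m arbitrary: z)
    case 0
    show ?case using summable_norm_exp[of z] by (simp add: divide_inverse mult.commute)
  next
    case (Suc m)
    \<comment> \<open>The extra factor \<open>n\<close> is paid for by doubling \<open>z\<close>,
      since \<open>n\<close> is at most \<open>2 ^ n\<close>; hence the induction with
      \<open>z\<close> arbitrary.\<close>
    have "norm (real n ^ Suc m / fact n * z ^ n) \<le> norm (real n ^ m / fact n * (2 * z) ^ n)" for n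
    proof -
      have "real n \<le> 2 ^ n" by (simp add: order_less_imp_le of_nat_less_two_power)
      hence "real n * (real n ^ m / fact n * \<bar>z\<bar> ^ n) \<le> 2 ^ n * (real n ^ m / fact n * \<bar>z\<bar> ^ n)"
        by (intro mult_right_mono) auto
      thus ?thesis by (simp add: abs_mult power_abs power_mult_distrib mult_ac)
    qed
    thus ?case by (intro summable_comparison_test'[OF Suc.IH[of "2*z"], of 0]) auto
  qed
  define m where "m = nat \<lceil>\<bar>\<alpha>\<bar>\<rceil>"
  have "norm (real n powr \<alpha> / fact n * z ^ n) \<le> norm (real n ^ m / fact n * z ^ n)" for n
  proof (cases "n = 0")
    case False
    have "real n powr \<alpha> \<le> real n powr real m"
      using False by (intro powr_mono) (auto simp: m_def, linarith)
    also have "\<dots> = real n ^ m" using False by (simp add: powr_realpow)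
    finally show ?thesis by (auto simp: abs_mult intro!: mult_right_mono divide_right_mono)
  qed auto
  thus ?thesis by (intro summable_comparison_test'[OF *[of m], of 0]) auto
qed

text \<open>Induction on the exponent: cancelling one factor of the factorial and shifting the index
  turns the series for j + 1 into z times the series with weights (n + 1)^j / n!. These are
  asymptotic to n^j / n!, so \<open>abelian_ratio\<close> reduces to the series for j.\<close>

lemma powr_exp_series_nat_asymp:
  "((\<lambda>z. powr_exp_series (real j) z / (z ^ j * exp z)) \<longlongrightarrow> 1) at_top"
proof (induction j)
  case 0
  have e: "powr_exp_series 0 z = exp z - 1" for z
  proof -
    have "exp z = (\<Sum>n. 1 / fact n * z ^ n)" by (simp add: exp_def divide_inverse)
    moreover have s: "summable (\<lambda>n. 1 / fact n * z ^ n)"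
      using summable_exp[of z] by (simp add: divide_inverse)
    ultimately have "exp z = 1 + (\<Sum>n. 1 / fact (Suc n) * z ^ Suc n)"
      using suminf_split_head[OF s] by simp
    moreover have "powr_exp_series 0 z = (\<Sum>n. 1 / fact (Suc n) * z ^ Suc n)"
      unfolding powr_exp_series_def using suminf_split_head[OF summable_powr_exp_series[of 0 z]] by simp
    ultimately show ?thesis by simp
  qed
  have "((\<lambda>z::real. 1 - exp (- z)) \<longlongrightarrow> 1 - 0) at_top"
    by (intro tendsto_intros filterlim_compose[OF exp_at_bot] filterlim_uminus_at_bot_at_top)
  then show ?case by (simp add: e exp_minus field_simps)
next
  case (Suc j)
  let ?a = "\<lambda>n. (real n + 1) powr real j / fact n"
  let ?b = "\<lambda>n. real n powr real j / fact n"
  have eq: "real (Suc n) powr real (Suc j) / fact (Suc n) * z ^ Suc n = z * (?a n * z ^ n)" for n z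
  proof -
    have "real (Suc n) powr real (Suc j) = real (Suc n) * (real n + 1) powr real j"
      by (simp add: powr_add add.commute)
    thus ?thesis by simp
  qed
  have S: "summable (\<lambda>n. z * (?a n * z ^ n))" for z
    using summable_ignore_initial_segment[OF summable_powr_exp_series[of "real (Suc j)" z], of 1] eq by simp
  have sa: "summable (\<lambda>n. ?a n * z ^ n)" for z
  proof (cases "z = 0")
    case False then show ?thesis using summable_mult[OF S[of z], of "1/z"] by simp
  next
    case True then show ?thesis by (auto intro!: summable_finite[of "{0}"])
  qed
  have ser: "powr_exp_series (real (Suc j)) z = z * (\<Sum>n. ?a n * z ^ n)" for z
  proof -
    have "powr_exp_series (real (Suc j)) z = (\<Sum>n. z * (?a n * z ^ n))"
      unfolding powr_exp_series_def
      using suminf_split_head[OF summable_powr_exp_series[of "real (Suc j)" z]] eq by simp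
    thus ?thesis using suminf_mult[OF sa] by simp
  qed
  have "(\<lambda>n. (1 + 1 / real n) ^ j) \<longlonglongrightarrow> (1 + 0) ^ j"
    by (intro tendsto_intros lim_1_over_n)
  moreover have "\<forall>\<^sub>F n in sequentially. (1 + 1 / real n) ^ j = ?a n / ?b n"
  proof (rule eventually_sequentiallyI[of 1])
    fix n :: nat assume "1 \<le> n"
    thus "(1 + 1 / real n) ^ j = ?a n / ?b n"
      by (simp add: powr_realpow add_pos_nonneg power_divide[symmetric] add_divide_distrib)
  qed
  ultimately have lim: "(\<lambda>n. ?a n / ?b n) \<longlonglongrightarrow> 1"
    by (auto elim: Lim_transform_eventually)
  have "((\<lambda>z. (\<Sum>n. ?a n * z ^ n) / powr_exp_series (real j) z) \<longlongrightarrow> 1) at_top"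
    unfolding powr_exp_series_def
    by (rule abelian_ratio[OF _ _ sa summable_powr_exp_series lim]) auto
  from tendsto_mult[OF this Suc.IH]
  have "((\<lambda>z. (\<Sum>n. ?a n * z ^ n) / powr_exp_series (real j) z * (powr_exp_series (real j) z / (z ^ j * exp z))) \<longlongrightarrow> 1) at_top" by simp
  moreover have "\<forall>\<^sub>F z in at_top. (\<Sum>n. ?a n * z ^ n) / powr_exp_series (real j) z * (powr_exp_series (real j) z / (z ^ j * exp z))
      = powr_exp_series (real (Suc j)) z / (z ^ Suc j * exp z)"
  proof -
    have "\<forall>\<^sub>F z in at_top. z > 0 \<and> powr_exp_series (real j) z / (z ^ j * exp z) > 1/2"
      using eventually_conj[OF eventually_gt_at_top[of 0] order_tendstoD(1)[OF Suc.IH, of "1/2"]] by simp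
    thus ?thesis by eventually_elim (auto simp: ser simp del: of_nat_Suc)
  qed
  ultimately show ?case by (rule Lim_transform_eventually)
qed

lemma powr_exp_series_pos: "z > 0 \<Longrightarrow> powr_exp_series \<alpha> z > 0"
  unfolding powr_exp_series_def
  by (rule suminf_pos2[OF summable_powr_exp_series, of _ _ 1]) auto

lemma powr_exp_series_Cauchy_Schwarz:
  assumes "z > 0"
  shows "(powr_exp_series ((\<alpha> + \<beta>) / 2) z)\<^sup>2 \<le> powr_exp_series \<alpha> z * powr_exp_series \<beta> z"
proof -
  let ?A = "powr_exp_series \<alpha> z" and ?B = "powr_exp_series \<beta> z" and ?M = "powr_exp_series ((\<alpha> + \<beta>) / 2) z"
  have A: "?A > 0" and B: "?B > 0" using powr_exp_series_pos assms by auto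
  \<comment> \<open>The weight that balances \<open>l * ?A\<close> and \<open>?B / l\<close>, so
    that the termwise inequality 2 p q <= l p^2 + q^2 / l sums to the Cauchy-Schwarz bound.\<close>
  define l where "l = sqrt (?B / ?A)"
  have l: "l > 0" using A B by (simp add: l_def)
  have *: "2 * (real n powr ((\<alpha> + \<beta>) / 2) / fact n * z ^ n) \<le>
     l * (real n powr \<alpha> / fact n * z ^ n) + (1 / l) * (real n powr \<beta> / fact n * z ^ n)" for n
  proof -
    define p q where "p = real n powr (\<alpha> / 2)" and "q = real n powr (\<beta> / 2)"
    have pq: "real n powr \<alpha> = p\<^sup>2" "real n powr \<beta> = q\<^sup>2" "real n powr ((\<alpha> + \<beta>) / 2) = p * q"
      by (simp_all add: p_def q_def power2_eq_square powr_add[symmetric] add_divide_distrib)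
    have "0 \<le> (l * p - q)\<^sup>2 / l" using l by simp
    also have "\<dots> = l * p\<^sup>2 + (1 / l) * q\<^sup>2 - 2 * (p * q)"
      using l by (simp add: field_simps power2_eq_square)
    finally have "2 * real n powr ((\<alpha> + \<beta>) / 2) \<le> l * real n powr \<alpha> + (1 / l) * real n powr \<beta>"
      by (simp add: pq)
    hence "2 * real n powr ((\<alpha> + \<beta>) / 2) * (z ^ n / fact n) \<le> (l * real n powr \<alpha> + (1 / l) * real n powr \<beta>) * (z ^ n / fact n)"
      using assms by (intro mult_right_mono) auto
    thus ?thesis by (simp add: algebra_simps)
  qed
  have "2 * ?M \<le> l * ?A + (1 / l) * ?B"
    unfolding powr_exp_series_def
    by (subst (1 2 3) suminf_mult[OF summable_powr_exp_series, symmetric],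
        subst suminf_add[OF summable_mult[OF summable_powr_exp_series] summable_mult[OF summable_powr_exp_series]])
       (intro suminf_le * summable_add summable_mult summable_powr_exp_series)
  also have "l * ?A = sqrt (?A * ?B)"
    using A B by (simp add: l_def real_sqrt_divide real_sqrt_mult field_simps)
  also have "(1 / l) * ?B = sqrt (?A * ?B)"
    using A B by (simp add: l_def real_sqrt_divide real_sqrt_mult field_simps)
  finally have "?M \<le> sqrt (?A * ?B)" by simp
  moreover have "0 < ?M" using powr_exp_series_pos assms by auto
  ultimately have "?M\<^sup>2 \<le> (sqrt (?A * ?B))\<^sup>2" by (intro power_mono) auto
  thus ?thesis using A B by simp
qed

text \<open>By Cauchy-Schwarz the series is log-convex in the exponent, so a half-integer exponent is
  controlled from above by its two integer neighbours, and then an integer one by its two half-integer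
  neighbours gives the bound from below.\<close>

lemma powr_exp_series_half_asymp:
  "((\<lambda>z. powr_exp_series (real j / 2) z / (z powr (real j / 2) * exp z)) \<longlongrightarrow> 1) at_top"
proof -
  define R where "R = (\<lambda>\<alpha> z. powr_exp_series \<alpha> z / (z powr \<alpha> * exp z))"
  have nat: "(R (real i) \<longlongrightarrow> 1) at_top" for i
    by (rule Lim_transform_eventually[OF powr_exp_series_nat_asymp])
       (use eventually_gt_at_top[of 0] in eventually_elim, auto simp: R_def powr_realpow)
  have cs: "(R ((\<alpha> + \<beta>) / 2) z)\<^sup>2 \<le> R \<alpha> z * R \<beta> z" if "z > 0" for \<alpha> \<beta> z
  proof -
    have "(z powr ((\<alpha> + \<beta>) / 2))\<^sup>2 = z powr \<alpha> * z powr \<beta>"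
      using that by (simp add: power2_eq_square powr_add[symmetric])
    then have "(R ((\<alpha> + \<beta>) / 2) z)\<^sup>2 = (powr_exp_series ((\<alpha> + \<beta>) / 2) z)\<^sup>2 / (z powr \<alpha> * z powr \<beta> * (exp z)\<^sup>2)"
      by (simp add: R_def power_divide power_mult_distrib)
    also have "\<dots> \<le> (powr_exp_series \<alpha> z * powr_exp_series \<beta> z) / (z powr \<alpha> * z powr \<beta> * (exp z)\<^sup>2)"
      using that by (intro divide_right_mono powr_exp_series_Cauchy_Schwarz) auto
    finally show ?thesis by (simp add: R_def power2_eq_square mult_ac)
  qed
  have pos: "R \<alpha> z > 0" if "z > 0" for \<alpha> z using that powr_exp_series_pos by (simp add: R_def)
  have half: "(R (real i + 1 / 2) \<longlongrightarrow> 1) at_top" for i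
  proof (rule tendsto_sandwich[where
      f = "\<lambda>z. (R (real (Suc i)) z)\<^sup>2 / sqrt (R (real (Suc i)) z * R (real (Suc (Suc i))) z)" and
      h = "\<lambda>z. sqrt (R (real i) z * R (real (Suc i)) z)"])
    have up: "R (real m + 1 / 2) z \<le> sqrt (R (real m) z * R (real (Suc m)) z)" if "z > 0" for m z
      using cs[OF that, of "real m" "real (Suc m)"] by (intro real_le_rsqrt) (simp add: field_simps)
    show "\<forall>\<^sub>F z in at_top. R (real i + 1 / 2) z \<le> sqrt (R (real i) z * R (real (Suc i)) z)"
      using eventually_gt_at_top[of 0] by eventually_elim (rule up)
    show "((\<lambda>z. sqrt (R (real i) z * R (real (Suc i)) z)) \<longlongrightarrow> 1) at_top"
      using tendsto_real_sqrt[OF tendsto_mult[OF nat[of i] nat[of "Suc i"]]] by simp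
    show "\<forall>\<^sub>F z in at_top. (R (real (Suc i)) z)\<^sup>2 / sqrt (R (real (Suc i)) z * R (real (Suc (Suc i))) z) \<le> R (real i + 1 / 2) z"
      using eventually_gt_at_top[of 0]
    proof eventually_elim
      case (elim z)
      let ?S = "sqrt (R (real (Suc i)) z * R (real (Suc (Suc i))) z)"
      have S: "?S > 0" using pos[OF elim] by simp
      have "(real i + 1 / 2 + (real (Suc i) + 1 / 2)) / 2 = real (Suc i)" by (simp add: field_simps)
      hence "(R (real (Suc i)) z)\<^sup>2 \<le> R (real i + 1/2) z * R (real (Suc i) + 1/2) z"
        using cs[OF elim, of "real i + 1/2" "real (Suc i) + 1/2"] by metis
      also have "\<dots> \<le> R (real i + 1/2) z * ?S"
        using up[OF elim, of "Suc i"] pos[OF elim] by (intro mult_left_mono) (auto intro: less_imp_le)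
      finally show ?case using S by (subst pos_divide_le_eq)
    qed
    show "((\<lambda>z. (R (real (Suc i)) z)\<^sup>2 / sqrt (R (real (Suc i)) z * R (real (Suc (Suc i))) z)) \<longlongrightarrow> 1) at_top"
      using tendsto_divide[OF tendsto_power[OF nat[of "Suc i"], of 2]
          tendsto_real_sqrt[OF tendsto_mult[OF nat[of "Suc i"] nat[of "Suc (Suc i)"]]]] by simp
  qed
  have "(R (real j / 2) \<longlongrightarrow> 1) at_top"
  proof (cases "even j")
    case True then obtain i where "j = 2 * i" by auto
    thus ?thesis using nat[of i] by simp
  next
    case False then obtain i where "j = 2 * i + 1" by (auto elim: oddE)
    hence "real j / 2 = real i + 1 / 2" by (simp add: field_simps)
    thus ?thesis using half[of i] by (simp only:)
  qed
  thus ?thesis by (simp add: R_def[abs_def])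
qed

text \<open>The value at the origin, at time \<open>s\<close>, of the heat flow with generator $\frac{1}{2} \Delta$ on
  $\mathbb{R}^k$ started from $\cosh |x|$.\<close>

definition cosh_heat_series :: "nat \<Rightarrow> real \<Rightarrow> real" where
  "cosh_heat_series k s = (\<Sum>j. 2 ^ j * pochhammer (real k / 2) j * s ^ j / fact (2 * j))"

text \<open>Since (2j)! = 4^j (1/2)_j j!, the series becomes an exponential series in s / 2 whose
  weights are a ratio of Pochhammer symbols with only polynomial growth.\<close>

lemma cosh_heat_term:
  "2 ^ j * pochhammer (real k / 2) j * s ^ j / fact (2 * j) =
   (pochhammer (real k / 2) j / pochhammer (1 / 2) j) / fact j * (s / 2) ^ j"
proof -
  have "pochhammer (1 / 2 :: real) j > 0" by (rule pochhammer_pos) simp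
  moreover have "fact (2 * j) = (2 ^ j * 2 ^ j * pochhammer (1 / 2) j * fact j :: real)"
    unfolding fact_double by (simp add: mult_2 power_add)
  ultimately show ?thesis by (simp add: power_divide)
qed

text \<open>Quotient of the limits n! n^x / (x)_(n+1) --> Gamma(x) at x = 1/2 and x = k/2. The
  Pochhammer symbols there have one factor more than those in the statement; the quotient of these
  last factors tends to 1.\<close>

lemma pochhammer_ratio_limit:
  assumes "k \<ge> 1"
  shows "(\<lambda>j. pochhammer (real k / 2) j / pochhammer (1 / 2) j / real j powr ((real k - 1) / 2))
           \<longlonglongrightarrow> sqrt pi / Gamma (real k / 2)"
proof -
  have nz: "real k / 2 > 0" using assms by simp
  have ne: "Gamma_series (1/2::real) \<longlonglongrightarrow> Gamma (1/2)" "Gamma_series (real k / 2) \<longlonglongrightarrow> Gamma (real k / 2)"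
    by (rule Gamma_series_LIMSEQ)+
  have G: "Gamma (real k / 2) > 0" using nz by (rule Gamma_real_pos)
  have L: "(\<lambda>n. Gamma_series (1/2) n / Gamma_series (real k / 2) n) \<longlonglongrightarrow> sqrt pi / Gamma (real k / 2)"
    using tendsto_divide[OF ne] G by (simp add: Gamma_one_half_real)
  have "(\<lambda>n. (1/2 + real n) / (real k / 2 + real n)) \<longlonglongrightarrow> 1"
    by real_asymp
  from tendsto_mult[OF L this] 
  have "(\<lambda>n. Gamma_series (1/2) n / Gamma_series (real k / 2) n * ((1/2 + real n) / (real k / 2 + real n))) \<longlonglongrightarrow> sqrt pi / Gamma (real k / 2)"
    by simp
  moreover have "\<forall>\<^sub>F n in sequentially. Gamma_series (1/2) n / Gamma_series (real k / 2) n * ((1/2 + real n) / (real k / 2 + real n))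
     = pochhammer (real k / 2) n / pochhammer (1 / 2) n / real n powr ((real k - 1) / 2)"
  proof (rule eventually_sequentiallyI[of 1])
    fix n :: nat assume n: "1 \<le> n"
    have p: "pochhammer (1 / 2 :: real) n > 0" "pochhammer (real k / 2) n > 0"
      using nz by (auto intro: pochhammer_pos)
    have e: "exp (x * ln (real n)) = real n powr x" for x using n by (simp add: powr_def)
    have w: "real n powr ((real k - 1) / 2) = real n powr (real k / 2) / real n powr (1 / 2)"
      by (simp only: powr_diff[symmetric] diff_divide_distrib)
    have alg: "(f * u / (p * a)) / (f * v / (q * b)) * (a / b) = q / p / (v / u)"
      if "f > 0" "u > 0" "v > 0" "p > 0" "q > 0" "a > 0" "b > 0" for f u v p q a b :: real
      using that by (simp add: field_simps)
    have pos: "1 / 2 + real n > 0" "real k / 2 + real n > 0" "real n powr (1 / 2) > 0" "real n powr (real k / 2) > 0"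
      using nz n by auto
    show "Gamma_series (1/2) n / Gamma_series (real k / 2) n * ((1/2 + real n) / (real k / 2 + real n))
     = pochhammer (real k / 2) n / pochhammer (1 / 2) n / real n powr ((real k - 1) / 2)"
      unfolding Gamma_series_def pochhammer_Suc Suc_eq_plus1[symmetric] of_real_eq_id id_apply e w
      by (rule alg[OF fact_gt_zero pos(3,4) p pos(1,2)])
  qed
  ultimately show ?thesis by (rule Lim_transform_eventually)
qed

lemma summable_pochhammer_ratio_series:
  assumes "k \<ge> 1"
  shows "summable (\<lambda>j. (pochhammer (real k / 2) j / pochhammer (1 / 2) j) / fact j * (z :: real) ^ j)"
proof -
  let ?a = "\<lambda>j. pochhammer (real k / 2) j / pochhammer (1 / 2 :: real) j"
  let ?p = "\<lambda>j. real j powr ((real k - 1) / 2)"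
  obtain K where K: "\<And>j. norm (?a j / ?p j) \<le> K"
    using convergent_imp_Bseq[OF convergentI[OF pochhammer_ratio_limit[OF assms]]] by (auto simp: Bseq_def)
  \<comment> \<open>At \<open>j = 0\<close> the comparison term is 0, so the estimate starts at
    1.\<close>
  have "norm (?a j / fact j * z ^ j) \<le> K * norm (?p j / fact j * z ^ j)" if "j \<ge> 1" for j
  proof -
    have "?a j / fact j * z ^ j = (?a j / ?p j) * (?p j / fact j * z ^ j)" using that by simp
    hence "norm (?a j / fact j * z ^ j) = norm (?a j / ?p j) * norm (?p j / fact j * z ^ j)"
      by (simp only: norm_mult)
    also have "\<dots> \<le> K * norm (?p j / fact j * z ^ j)" by (rule mult_right_mono[OF K norm_ge_zero])
    finally show ?thesis .
  qed
  moreover have "summable (\<lambda>j. K * norm (?p j / fact j * z ^ j))"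
    using summable_powr_exp_series[of "(real k - 1) / 2" "\<bar>z\<bar>"]
    by (intro summable_mult) (simp add: abs_mult power_abs)
  ultimately show ?thesis by (rule summable_comparison_test'[rotated])
qed

lemma summable_cosh_heat_series:
  assumes "k \<ge> 1"
  shows "summable (\<lambda>j. 2 ^ j * pochhammer (real k / 2) j * s ^ j / fact (2 * j))"
  unfolding cosh_heat_term using assms by (rule summable_pochhammer_ratio_series)

text \<open>The Abelian comparison at z = s / 2 gives F(s) ~ sqrt pi / Gamma(k/2) * (s/2)^((k-1)/2)
  * exp (s/2). Doubling, and writing Gamma(k/2) through Gamma(k/2 + 1) = (k/2) Gamma(k/2), produces
  the constant of the theorem.\<close>

lemma cosh_heat_series_asymp:
  assumes "k \<ge> 1"
  shows "((\<lambda>s. 2 * cosh_heat_series k s /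
            (real k * sqrt pi / (2 powr ((real k - 1) / 2) * Gamma (real k / 2 + 1))
              * s powr ((real k - 1) / 2) * exp (s / 2))) \<longlongrightarrow> 1) at_top"
proof -
  let ?\<alpha> = "(real k - 1) / 2"
  let ?a = "\<lambda>j. pochhammer (real k / 2) j / pochhammer (1 / 2 :: real) j / fact j"
  let ?G = "Gamma (real k / 2)"
  have G: "?G > 0" using assms by (intro Gamma_real_pos) simp
  have \<alpha>: "?\<alpha> = real (k - 1) / 2" using assms by (simp add: of_nat_diff)
  have "((\<lambda>z. (\<Sum>j. ?a j * z ^ j) / powr_exp_series ?\<alpha> z) \<longlongrightarrow> sqrt pi / ?G) at_top"
    unfolding powr_exp_series_def
  proof (rule abelian_ratio[OF _ _ summable_pochhammer_ratio_series[OF assms] summable_powr_exp_series])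
    show "(\<lambda>n. ?a n / (real n powr ?\<alpha> / fact n)) \<longlonglongrightarrow> sqrt pi / ?G"
      using pochhammer_ratio_limit[OF assms] by simp
  qed auto
  hence "((\<lambda>z. (\<Sum>j. ?a j * z ^ j) / powr_exp_series ?\<alpha> z * (powr_exp_series ?\<alpha> z / (z powr ?\<alpha> * exp z)))
           \<longlongrightarrow> sqrt pi / ?G * 1) at_top"
    by (rule tendsto_mult[OF _ powr_exp_series_half_asymp[of "k - 1", folded \<alpha>]])
  hence lim: "((\<lambda>z. ?G / sqrt pi * ((\<Sum>j. ?a j * z ^ j) / powr_exp_series ?\<alpha> z * (powr_exp_series ?\<alpha> z / (z powr ?\<alpha> * exp z))))
           \<longlongrightarrow> ?G / sqrt pi * (sqrt pi / ?G * 1)) at_top"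
    by (rule tendsto_mult_left)
  have one: "?G / sqrt pi * (sqrt pi / ?G * 1) = 1" using G by simp
  have "filterlim (\<lambda>s::real. s / 2) at_top at_top" by real_asymp
  from filterlim_compose[OF lim[unfolded one] this]
  have "((\<lambda>s. ?G / sqrt pi * ((\<Sum>j. ?a j * (s / 2) ^ j) / powr_exp_series ?\<alpha> (s / 2) * (powr_exp_series ?\<alpha> (s / 2) / ((s / 2) powr ?\<alpha> * exp (s / 2)))))
           \<longlongrightarrow> 1) at_top" .
  moreover have "\<forall>\<^sub>F s in at_top. ?G / sqrt pi * ((\<Sum>j. ?a j * (s / 2) ^ j) / powr_exp_series ?\<alpha> (s / 2) * (powr_exp_series ?\<alpha> (s / 2) / ((s / 2) powr ?\<alpha> * exp (s / 2))))
     = 2 * cosh_heat_series k s / (real k * sqrt pi / (2 powr ?\<alpha> * Gamma (real k / 2 + 1)) * s powr ?\<alpha> * exp (s / 2))"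
    using eventually_gt_at_top[of 0]
  proof eventually_elim
    case (elim s)
    have p1: "Gamma (real k / 2 + 1) = real k / 2 * ?G"
      using assms by (intro Gamma_plus1) (auto elim!: nonpos_Ints_cases)
    have p2: "powr_exp_series ?\<alpha> (s / 2) > 0" using elim by (intro powr_exp_series_pos) simp
    have p3: "(s / 2) powr ?\<alpha> = s powr ?\<alpha> / 2 powr ?\<alpha>" using elim by (simp add: powr_divide)
    have alg: "g / p * (F / S * (S / (u / v * e))) = 2 * F / (c * p / (v * (c / 2 * g)) * u * e)"
      if "g > 0" "p > 0" "S > 0" "u > 0" "v > 0" "e > 0" "c > 0" for g p F S u v e c :: real
      using that by (simp add: field_simps)
    have pos: "s powr ?\<alpha> > 0" "2 powr ?\<alpha> > 0" "exp (s / 2) > 0" "sqrt pi > 0" "real k > 0"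
      using elim assms by auto
    show ?case
      unfolding cosh_heat_series_def cosh_heat_term p1 p3
      by (rule alg[OF G pos(4) p2 pos(1,2,3,5)])
  qed
  ultimately show ?thesis by (rule Lim_transform_eventually)
qed

section \<open>Maximum principle for the backward heat equation\<close>

text \<open>\<open>G\<close> is assumed differentiable at 0 only. If \<open>h\<close> were positive,
  then \<open>G\<close>, which vanishes at 0, would be positive just to the right of 0, and the mean
  value theorem would make \<open>F\<close> exceed its maximum.\<close>

lemma second_derivative_at_max:
  fixes F G :: "real \<Rightarrow> real"
  assumes F: "\<And>r. (F has_real_derivative G r) (at r)" and G: "(G has_real_derivative h) (at 0)"
    and max: "\<And>r. F r \<le> F 0"
  shows "h \<le> 0"
proof (rule ccontr)
  assume "\<not> h \<le> 0"
  hence "h > 0" by simp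
  have G0: "G 0 = 0" using DERIV_local_max[OF F[of 0], of 1] max by auto
  from DERIV_pos_inc_right[OF G \<open>h > 0\<close>]
  obtain d where d: "d > 0" "\<And>r. 0 < r \<Longrightarrow> r < d \<Longrightarrow> G r > 0" using G0 by auto
  obtain z where z: "0 < z" "z < d / 2" "F (d / 2) - F 0 = (d / 2 - 0) * G z"
    using MVT2[of 0 "d / 2" F G] F d(1) by auto
  have "(d / 2 - 0) * G z > 0" using d z by (intro mult_pos_pos) auto
  hence "F (d / 2) - F 0 > 0" using z by linarith
  thus False using max[of "d / 2"] by simp
qed

lemma has_real_derivative_along_line:
  fixes f :: "real ^ 'n \<Rightarrow> real"
  assumes "(f has_derivative f') (at x)"
  shows "((\<lambda>r. f (x + r *\<^sub>R v)) has_real_derivative f' v) (at 0)"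
proof -
  have lin: "linear f'" using assms by (rule has_derivative_linear)
  have "((\<lambda>r::real. x + r *\<^sub>R v) has_derivative (\<lambda>r. r *\<^sub>R v)) (at 0)"
    by (auto intro!: derivative_eq_intros)
  moreover have "(f has_derivative f') (at (x + 0 *\<^sub>R v))" using assms by simp
  ultimately have "((\<lambda>r. f (x + r *\<^sub>R v)) has_derivative (\<lambda>r. f' (r *\<^sub>R v))) (at 0)"
    by (rule has_derivative_compose)
  moreover have "(\<lambda>r. f' (r *\<^sub>R v)) = (*) (f' v)"
    using linear_scale[OF lin] by (auto simp: mult.commute)
  ultimately show ?thesis by (simp add: has_field_derivative_def)
qed

text \<open>The Laplacian enters only through the pure second derivatives \<open>h t x i\<close> along the axes.\<close>

definition backward_caloric :: "real \<Rightarrow> real \<Rightarrow> (real \<Rightarrow> real ^ 'n \<Rightarrow> real) \<Rightarrow> bool" where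
  "backward_caloric \<epsilon> T w \<longleftrightarrow>
     continuous_on ({0..T} \<times> UNIV) (\<lambda>(t, x). w t x) \<and>
     (\<exists>Dt g h. \<forall>t\<in>{0..<T}. \<forall>x.
        ((\<lambda>s. w s x) has_real_derivative Dt t x) (at t within {0..<T}) \<and>
        (\<forall>i. ((\<lambda>r. w t (x + r *\<^sub>R axis i 1)) has_real_derivative g t x i) (at 0) \<and>
             ((\<lambda>r. g t (x + r *\<^sub>R axis i 1) i) has_real_derivative h t x i) (at 0)) \<and>
        Dt t x + \<epsilon> / 2 * (\<Sum>i\<in>UNIV. h t x i) = 0)"

lemma backward_caloric_add:
  assumes "backward_caloric \<epsilon> T v" "backward_caloric \<epsilon> T w"
  shows "backward_caloric \<epsilon> T (\<lambda>t x. v t x + w t x)"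
proof -
  from assms(1) obtain D g h where v: "\<And>t x. t \<in> {0..<T} \<Longrightarrow>
        ((\<lambda>s. v s x) has_real_derivative D t x) (at t within {0..<T}) \<and>
        (\<forall>i. ((\<lambda>r. v t (x + r *\<^sub>R axis i 1)) has_real_derivative g t x i) (at 0) \<and>
             ((\<lambda>r. g t (x + r *\<^sub>R axis i 1) i) has_real_derivative h t x i) (at 0)) \<and>
        D t x + \<epsilon> / 2 * (\<Sum>i\<in>UNIV. h t x i) = 0" and cv: "continuous_on ({0..T} \<times> UNIV) (\<lambda>(t, x). v t x)"
    unfolding backward_caloric_def by blast
  from assms(2) obtain D' g' h' where w: "\<And>t x. t \<in> {0..<T} \<Longrightarrow>
        ((\<lambda>s. w s x) has_real_derivative D' t x) (at t within {0..<T}) \<and>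
        (\<forall>i. ((\<lambda>r. w t (x + r *\<^sub>R axis i 1)) has_real_derivative g' t x i) (at 0) \<and>
             ((\<lambda>r. g' t (x + r *\<^sub>R axis i 1) i) has_real_derivative h' t x i) (at 0)) \<and>
        D' t x + \<epsilon> / 2 * (\<Sum>i\<in>UNIV. h' t x i) = 0" and cw: "continuous_on ({0..T} \<times> UNIV) (\<lambda>(t, x). w t x)"
    unfolding backward_caloric_def by blast
  have "continuous_on ({0..T} \<times> UNIV) (\<lambda>(t, x). v t x + w t x)"
    using continuous_on_add[OF cv cw] by (simp add: split_beta)
  moreover have "((\<lambda>s. v s x + w s x) has_real_derivative D t x + D' t x) (at t within {0..<T}) \<and>
        (\<forall>i. ((\<lambda>r. v t (x + r *\<^sub>R axis i 1) + w t (x + r *\<^sub>R axis i 1)) has_real_derivative g t x i + g' t x i) (at 0) \<and>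
             ((\<lambda>r. g t (x + r *\<^sub>R axis i 1) i + g' t (x + r *\<^sub>R axis i 1) i) has_real_derivative h t x i + h' t x i) (at 0)) \<and>
        D t x + D' t x + \<epsilon> / 2 * (\<Sum>i\<in>UNIV. h t x i + h' t x i) = 0" if "t \<in> {0..<T}" for t x
    using v[OF that, of x] w[OF that, of x]
    by (auto intro!: DERIV_add simp: sum.distrib distrib_left)
  ultimately show ?thesis
    unfolding backward_caloric_def
    by (intro conjI exI[of _ "\<lambda>t x. D t x + D' t x"] exI[of _ "\<lambda>t x i. g t x i + g' t x i"]
        exI[of _ "\<lambda>t x i. h t x i + h' t x i"] ballI allI) auto
qed

lemma backward_caloric_cmult:
  assumes "backward_caloric \<epsilon> T v"
  shows "backward_caloric \<epsilon> T (\<lambda>t x. c * v t x)"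
proof -
  from assms(1) obtain D g h where v: "\<And>t x. t \<in> {0..<T} \<Longrightarrow>
        ((\<lambda>s. v s x) has_real_derivative D t x) (at t within {0..<T}) \<and>
        (\<forall>i. ((\<lambda>r. v t (x + r *\<^sub>R axis i 1)) has_real_derivative g t x i) (at 0) \<and>
             ((\<lambda>r. g t (x + r *\<^sub>R axis i 1) i) has_real_derivative h t x i) (at 0)) \<and>
        D t x + \<epsilon> / 2 * (\<Sum>i\<in>UNIV. h t x i) = 0" and cv: "continuous_on ({0..T} \<times> UNIV) (\<lambda>(t, x). v t x)"
    unfolding backward_caloric_def by blast
  have "continuous_on ({0..T} \<times> UNIV) (\<lambda>(t, x). c * v t x)"
    using continuous_on_mult_left[OF cv, of c] by (simp add: split_beta)
  moreover have "((\<lambda>s. c * v s x) has_real_derivative c * D t x) (at t within {0..<T}) \<and>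
        (\<forall>i. ((\<lambda>r. c * v t (x + r *\<^sub>R axis i 1)) has_real_derivative c * g t x i) (at 0) \<and>
             ((\<lambda>r. c * g t (x + r *\<^sub>R axis i 1) i) has_real_derivative c * h t x i) (at 0)) \<and>
        c * D t x + \<epsilon> / 2 * (\<Sum>i\<in>UNIV. c * h t x i) = 0" if "t \<in> {0..<T}" for t x
  proof -
    have "c * (D t x + \<epsilon> / 2 * (\<Sum>i\<in>UNIV. h t x i)) = 0" using v[OF that, of x] by simp
    thus ?thesis using v[OF that, of x]
      by (auto intro!: DERIV_cmult simp: sum_distrib_left[symmetric] distrib_left mult_ac)
  qed
  ultimately show ?thesis
    unfolding backward_caloric_def
    by (intro conjI exI[of _ "\<lambda>t x. c * D t x"] exI[of _ "\<lambda>t x i. c * g t x i"]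
        exI[of _ "\<lambda>t x i. c * h t x i"] ballI allI) auto
qed

lemma backward_caloric_const: "backward_caloric \<epsilon> T (\<lambda>t x. c)"
  unfolding backward_caloric_def
  by (intro conjI exI[of _ "\<lambda>t x. 0"] exI[of _ "\<lambda>t x i. 0"]) (auto simp: split_beta)

lemma backward_caloric_sum:
  assumes "\<And>j. j \<in> J \<Longrightarrow> backward_caloric \<epsilon> T (w j)"
  shows "backward_caloric \<epsilon> T (\<lambda>t x. \<Sum>j\<in>J. w j t x)"
  using assms
  by (induction J rule: infinite_finite_induct) (auto intro: backward_caloric_const backward_caloric_add)

text \<open>The spatial factor of the penalty in the maximum principle: an eigenfunction of the Laplacian
  growing at least like \<open>exp (b * norm x)\<close>.\<close>

definition cosh_gauge :: "real \<Rightarrow> real ^ 'n \<Rightarrow> real" where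
  "cosh_gauge b x = (\<Sum>i\<in>UNIV. cosh (real CARD('n) * b * x $ i))" for x :: "real ^ 'n"

text \<open>Some coordinate carries at least the fraction 1 / \<open>CARD('n)\<close> of the norm;
  this is the origin of the factor \<open>CARD('n)\<close> in the gauge.\<close>

lemma exp_le_cosh_gauge:
  fixes x :: "real ^ 'n"
  assumes "b \<ge> 0"
  shows "exp (b * norm x) \<le> 2 * cosh_gauge b x"
proof -
  have "\<exists>i. norm x \<le> real CARD('n) * \<bar>x $ i\<bar>"
  proof (rule ccontr)
    assume "\<nexists>i. norm x \<le> real CARD('n) * \<bar>x $ i\<bar>"
    hence "\<bar>x $ i\<bar> < norm x / real CARD('n)" for i by (simp add: field_simps not_le)
    hence "(\<Sum>i\<in>UNIV. \<bar>x $ i\<bar>) < (\<Sum>i\<in>(UNIV :: 'n set). norm x / real CARD('n))"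
      by (intro sum_strict_mono) auto
    with norm_le_l1_cart[of x] show False by simp
  qed
  then obtain i where i: "norm x \<le> real CARD('n) * \<bar>x $ i\<bar>" by blast
  let ?y = "real CARD('n) * b * x $ i"
  have "b * norm x \<le> \<bar>?y\<bar>"
    using mult_left_mono[OF i assms] assms by (simp add: abs_mult mult_ac)
  hence "exp (b * norm x) \<le> exp \<bar>?y\<bar>" by simp
  also have "\<dots> \<le> 2 * cosh ?y" by (auto simp: cosh_def abs_if)
  also have "cosh ?y \<le> cosh_gauge b x"
    unfolding cosh_gauge_def by (rule member_le_sum[where f = "\<lambda>i. cosh (real CARD('n) * b * x $ i)"]) auto
  finally show ?thesis by simp
qed

lemma cosh_gauge_along_axis:
  fixes x :: "real ^ 'n"
  shows "cosh_gauge b (x + r *\<^sub>R axis i 1) =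
    cosh_gauge b x - cosh (real CARD('n) * b * x $ i) + cosh (real CARD('n) * b * (x $ i + r))"
proof -
  have "cosh_gauge b y = (\<Sum>j\<in>UNIV - {i}. cosh (real CARD('n) * b * y $ j)) + cosh (real CARD('n) * b * y $ i)"
    for y :: "real ^ 'n"
    unfolding cosh_gauge_def by (subst sum.remove[of _ i]) auto
  from this[of x] this[of "x + r *\<^sub>R axis i 1"] show ?thesis
    by (simp add: axis_def)
qed

lemma continuous_on_cosh_gauge [continuous_intros]: "continuous_on A (cosh_gauge b :: real ^ 'n \<Rightarrow> real)"
  unfolding cosh_gauge_def by (intro continuous_intros)

text \<open>The right-hand side P is a strict supersolution that dominates \<open>w\<close> at the
  final time and, because \<open>C < b\<close>, outside a large ball; so a positive value of w - P
  would give an attained maximum before T, where the derivative tests contradict the equation. In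
  the bound, the factor of \<eta> depends on neither \<open>w\<close> nor \<open>K\<close> nor
  \<open>C\<close>, which is what allows limits in truncation order or in \<eta>.\<close>

lemma backward_caloric_maximum_principle:
  fixes w :: "real \<Rightarrow> real ^ 'n \<Rightarrow> real"
  assumes cal: "backward_caloric \<epsilon> T w" and "\<epsilon> > 0" "\<eta> > 0" "b > 0" "C < b" "K > 0"
    and growth: "\<And>t x. t \<in> {0..T} \<Longrightarrow> w t x \<le> K * exp (C * norm x)"
    and final: "\<And>x. w T x \<le> \<eta> * exp (b * norm x)"
    and t: "t \<in> {0..T}"
  shows "w t x \<le> 2 * \<eta> * exp (\<epsilon> * (real CARD('n) * b)\<^sup>2 * (T - t)) * cosh_gauge b x"
proof (rule ccontr)
  let ?a = "real CARD('n) * b"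
  \<comment> \<open>The gauge has Laplace eigenvalue \<open>?a\<^sup>2\<close>, so the rate
    \<epsilon> \<open>?a\<^sup>2 / 2\<close> would make P caloric; twice that rate gives the strict
    inequality.\<close>
  define B where "B = \<epsilon> * ?a\<^sup>2"
  define P where "P = (\<lambda>t (x :: real ^ 'n). 2 * \<eta> * exp (B * (T - t)) * cosh_gauge b x)"
  define f where "f = (\<lambda>(t, x). w t x - P t x)"
  have a: "?a > 0" using assms by simp
  have B: "B > 0" using a assms by (simp add: B_def)
  assume "\<not> ?thesis"
  hence f1: "f (t, x) > 0" by (simp add: f_def P_def B_def)
  have P_ge: "P s y \<ge> \<eta> * exp (b * norm y)" if "s \<in> {0..T}" for s y
  proof -
    have "\<eta> * exp (b * norm y) \<le> \<eta> * (2 * cosh_gauge b y)"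
      using exp_le_cosh_gauge[of b y] assms by (intro mult_left_mono) auto
    also have "\<dots> = 2 * \<eta> * 1 * cosh_gauge b y" by simp
    also have "\<dots> \<le> P s y"
      unfolding P_def using that assms B
      by (intro mult_right_mono mult_left_mono) (auto simp: cosh_gauge_def intro!: sum_nonneg)
    finally show ?thesis .
  qed
  \<comment> \<open>Outside radius K / (\<eta> (b - C)), the inequality exp r >= r already gives K
    exp (C |y|) <= \<eta> exp (b |y|).\<close>
  define R where "R = max (norm x) (K / (\<eta> * (b - C)))"
  have out: "f (s, y) \<le> 0" if "s \<in> {0..T}" "norm y \<ge> R" for s y
  proof -
    have "K / (\<eta> * (b - C)) \<le> norm y" using that R_def by simp
    hence "K \<le> \<eta> * ((b - C) * norm y)" using assms by (simp add: field_simps)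
    also have "\<dots> \<le> \<eta> * exp ((b - C) * norm y)"
      using \<open>\<eta> > 0\<close> less_imp_le[OF exp_gt_self] by (intro mult_left_mono) auto
    finally have "K * exp (C * norm y) \<le> \<eta> * exp ((b - C) * norm y) * exp (C * norm y)"
      by (intro mult_right_mono) auto
    also have "\<dots> = \<eta> * exp (b * norm y)" by (simp add: exp_add[symmetric] algebra_simps)
    finally show ?thesis using growth[of s y] P_ge[of s y] that by (simp add: f_def)
  qed
  have finalf: "f (T, y) \<le> 0" for y
    using final[of y] P_ge[of T y] t by (simp add: f_def)
  have contf: "continuous_on ({0..T} \<times> UNIV) f"
  proof -
    have "continuous_on ({0..T} \<times> (UNIV :: (real ^ 'n) set)) (\<lambda>p. P (fst p) (snd p))"
      unfolding P_def
      by (intro continuous_intros continuous_on_compose2[OF continuous_on_cosh_gauge[of UNIV]]) auto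
    with cal have "continuous_on ({0..T} \<times> UNIV) (\<lambda>p. w (fst p) (snd p) - P (fst p) (snd p))"
      unfolding backward_caloric_def by (intro continuous_on_diff) (auto simp: split_beta)
    thus ?thesis by (simp add: f_def split_beta)
  qed
  have "\<exists>p\<in>{0..T} \<times> cball 0 R. \<forall>q\<in>{0..T} \<times> cball 0 R. f q \<le> f p"
  proof (rule continuous_attains_sup)
    show "compact ({0..T} \<times> cball (0 :: real ^ 'n) R)" by (intro compact_Times) auto
    have "(t, x) \<in> {0..T} \<times> cball 0 R" using t by (simp add: R_def)
    thus "{0..T} \<times> cball (0 :: real ^ 'n) R \<noteq> {}" by blast
    show "continuous_on ({0..T} \<times> cball 0 R) f" by (rule continuous_on_subset[OF contf]) auto
  qed
  then obtain t0 x0 where t0: "t0 \<in> {0..T}"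
    and max0': "\<forall>q\<in>{0..T} \<times> cball 0 R. f q \<le> f (t0, x0)" by auto
  have max0: "f (s, y) \<le> f (t0, x0)" if "s \<in> {0..T}" "norm y \<le> R" for s y
    using max0' that by simp
  have pos: "f (t0, x0) > 0" using max0[of t x] f1 t by (simp add: R_def)
  have max: "f (s, y) \<le> f (t0, x0)" if "s \<in> {0..T}" for s y
    using max0[of s y] out[of s y] pos that by (cases "norm y \<le> R") auto
  have t0': "t0 \<in> {0..<T}" using t0 finalf[of x0] pos by (cases "t0 = T") auto
  from cal obtain D g h where w: "\<And>t x. t \<in> {0..<T} \<Longrightarrow>
        ((\<lambda>s. w s x) has_real_derivative D t x) (at t within {0..<T}) \<and>
        (\<forall>i. ((\<lambda>r. w t (x + r *\<^sub>R axis i 1)) has_real_derivative g t x i) (at 0) \<and>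
             ((\<lambda>r. g t (x + r *\<^sub>R axis i 1) i) has_real_derivative h t x i) (at 0)) \<and>
        D t x + \<epsilon> / 2 * (\<Sum>i\<in>UNIV. h t x i) = 0"
    unfolding backward_caloric_def by blast
  \<comment> \<open>\<open>t0\<close> may be 0, where only the derivative from the right exists;
    that one is still nonpositive at a maximum.\<close>
  have "D t0 x0 + B * P t0 x0 \<le> 0"
  proof (rule ccontr)
    assume "\<not> ?thesis"
    moreover have "((\<lambda>s. f (s, x0)) has_real_derivative D t0 x0 + B * P t0 x0) (at t0 within {0..<T})"
      unfolding f_def P_def using w[OF t0', of x0]
      by (auto intro!: derivative_eq_intros)
    ultimately obtain d where d: "d > 0" "\<And>r. r > 0 \<Longrightarrow> t0 + r \<in> {0..<T} \<Longrightarrow> r < d \<Longrightarrow> f (t0, x0) < f (t0 + r, x0)"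
      using has_real_derivative_pos_inc_right[of "\<lambda>s. f (s, x0)" "D t0 x0 + B * P t0 x0" t0 "{0..<T}"] by auto
    define r where "r = min d (T - t0) / 2"
    have "0 < r" "r < d" "t0 + r \<in> {0..<T}" using d(1) t0' by (auto simp: r_def min_def field_simps)
    with d(2)[of r] max[of "t0 + r" x0] show False by auto
  qed
  moreover have "h t0 x0 i \<le> 2 * \<eta> * exp (B * (T - t0)) * (?a\<^sup>2 * cosh (?a * x0 $ i))" for i
  proof -
    let ?c = "2 * \<eta> * exp (B * (T - t0))"
    let ?F = "\<lambda>r. f (t0, x0 + r *\<^sub>R axis i 1)"
    let ?G = "\<lambda>r. g t0 (x0 + r *\<^sub>R axis i 1) i - ?c * (?a * sinh (?a * (x0 $ i + r)))"
    have "(?F has_real_derivative ?G r) (at r)" for r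
    proof -
      have "((\<lambda>s. w t0 (x0 + r *\<^sub>R axis i 1 + s *\<^sub>R axis i 1)) has_real_derivative g t0 (x0 + r *\<^sub>R axis i 1) i) (at 0)"
        using w[OF t0'] by blast
      hence "((\<lambda>s. w t0 (x0 + (s + r) *\<^sub>R axis i 1)) has_real_derivative g t0 (x0 + r *\<^sub>R axis i 1) i) (at 0)"
        by (simp add: algebra_simps)
      hence "((\<lambda>s. w t0 (x0 + s *\<^sub>R axis i 1)) has_real_derivative g t0 (x0 + r *\<^sub>R axis i 1) i) (at r)"
        using DERIV_shift[of "\<lambda>s. w t0 (x0 + s *\<^sub>R axis i 1)" _ 0 r] by simp
      thus ?thesis
        unfolding f_def P_def prod.case cosh_gauge_along_axis
        by (auto intro!: derivative_eq_intros)
    qed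
    moreover have "(?G has_real_derivative h t0 x0 i - ?c * (?a\<^sup>2 * cosh (?a * x0 $ i))) (at 0)"
      using w[OF t0', of x0]
      by (auto intro!: derivative_eq_intros simp: power2_eq_square)
    moreover have "?F r \<le> ?F 0" for r using max[of t0] t0 by simp
    ultimately have "h t0 x0 i - ?c * (?a\<^sup>2 * cosh (?a * x0 $ i)) \<le> 0"
      by (rule second_derivative_at_max)
    thus ?thesis by simp
  qed
  hence "(\<Sum>i\<in>UNIV. h t0 x0 i) \<le> (\<Sum>i\<in>UNIV. 2 * \<eta> * exp (B * (T - t0)) * (?a\<^sup>2 * cosh (?a * x0 $ i)))"
    by (rule sum_mono)
  hence "(\<Sum>i\<in>UNIV. h t0 x0 i) \<le> ?a\<^sup>2 * P t0 x0"
    by (simp add: P_def cosh_gauge_def sum_distrib_left mult_ac)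
  hence "\<epsilon> / 2 * (\<Sum>i\<in>UNIV. h t0 x0 i) \<le> \<epsilon> / 2 * (?a\<^sup>2 * P t0 x0)"
    using assms by (intro mult_left_mono) auto
  moreover have "P t0 x0 > 0"
    using P_ge[OF t0, of x0] assms by (smt (verit) exp_gt_zero mult_pos_pos)
  moreover have "\<epsilon> / 2 * (?a\<^sup>2 * P t0 x0) = B * P t0 x0 / 2" by (simp add: B_def)
  moreover have "B * P t0 x0 > 0" using B calculation by simp
  \<comment> \<open>The equation now reads 0 = D + \<epsilon>/2 * (sum of h) <= - B P + B P / 2 <
    0.\<close>
  ultimately show False using w[OF t0', of x0] by linarith
qed

section \<open>Cole-Hopf transform and heat polynomials\<close>

text \<open>Differentiating the exponential twice in space creates the squared gradient with exactly
  the coefficient of the Hamiltonian: the backward heat operator applied to u equals u / \<epsilon>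
  times the residual of the viscous equation.\<close>

lemma backward_caloric_Cole_Hopf:
  fixes \<phi> :: "real \<Rightarrow> real ^ 'n \<Rightarrow> real"
  assumes sol: "viscous_HJ_classical_solution \<epsilon> T g0 \<phi>" and \<epsilon>: "\<epsilon> > 0"
  shows "backward_caloric \<epsilon> T (\<lambda>t x. exp (- \<phi> t x / \<epsilon>))"
proof -
  from sol have cont: "continuous_on ({0..T} \<times> UNIV) (\<lambda>(t, x). \<phi> t x)"
    by (simp add: viscous_HJ_classical_solution_def)
  from sol obtain Dt :: "real \<Rightarrow> real ^ 'n \<Rightarrow> real" and G :: "real \<Rightarrow> real ^ 'n \<Rightarrow> real ^ 'n"
    and H :: "real \<Rightarrow> real ^ 'n \<Rightarrow> real ^ 'n ^ 'n" where
    d: "\<And>t x. t \<in> {0..<T} \<Longrightarrow> ((\<lambda>s. \<phi> s x) has_real_derivative Dt t x) (at t within {0..<T}) \<and>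
           (\<phi> t has_derivative (\<lambda>v. G t x \<bullet> v)) (at x) \<and>
           (G t has_derivative (\<lambda>v. H t x *v v)) (at x)"
    and pde: "\<And>t x. t \<in> {0..<T} \<Longrightarrow> - Dt t x + 1 / 2 * (norm (G t x))\<^sup>2 = \<epsilon> / 2 * trace (H t x)"
    unfolding viscous_HJ_classical_solution_def by blast
  define u where "u = (\<lambda>t x. exp (- \<phi> t x / \<epsilon>))"
  have "continuous_on ({0..T} \<times> UNIV) (\<lambda>(t, x). u t x)"
    using cont \<epsilon> unfolding u_def split_beta by (intro continuous_intros) auto
  moreover have "((\<lambda>s. u s x) has_real_derivative - u t x * Dt t x / \<epsilon>) (at t within {0..<T})"
    if "t \<in> {0..<T}" for t x
    using d[OF that, of x] \<epsilon> unfolding u_def by (auto intro!: derivative_eq_intros)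
  moreover have ux: "((\<lambda>r. u t (x + r *\<^sub>R axis i 1)) has_real_derivative - u t x * (G t x $ i) / \<epsilon>) (at 0)"
    if "t \<in> {0..<T}" for t x i
  proof -
    have "((\<lambda>r. \<phi> t (x + r *\<^sub>R axis i 1)) has_real_derivative G t x $ i) (at 0)"
      using has_real_derivative_along_line[of "\<phi> t" "\<lambda>v. G t x \<bullet> v" x "axis i 1"] d[OF that, of x]
      by (simp add: inner_axis)
    thus ?thesis using \<epsilon> unfolding u_def by (auto intro!: derivative_eq_intros)
  qed
  moreover have "((\<lambda>r. - u t (x + r *\<^sub>R axis i 1) * (G t (x + r *\<^sub>R axis i 1) $ i) / \<epsilon>)
       has_real_derivative u t x * ((G t x $ i)\<^sup>2 / \<epsilon>\<^sup>2 - H t x $ i $ i / \<epsilon>)) (at 0)"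
    if "t \<in> {0..<T}" for t x i
  proof -
    have "((\<lambda>y. G t y $ i) has_derivative (\<lambda>v. (H t x *v v) $ i)) (at x)"
      using d[OF that, of x] by (intro bounded_linear.has_derivative[OF bounded_linear_vec_nth]) auto
    from has_real_derivative_along_line[OF this, of "axis i 1"]
    have "((\<lambda>r. G t (x + r *\<^sub>R axis i 1) $ i) has_real_derivative H t x $ i $ i) (at 0)"
      by (simp add: matrix_vector_mul_component inner_axis)
    with ux[OF that, of x i] show ?thesis using \<epsilon>
      by (auto intro!: derivative_eq_intros simp: field_simps power2_eq_square)
  qed
  moreover have "- u t x * Dt t x / \<epsilon> + \<epsilon> / 2 * (\<Sum>i\<in>UNIV. u t x * ((G t x $ i)\<^sup>2 / \<epsilon>\<^sup>2 - H t x $ i $ i / \<epsilon>)) = 0"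
    if "t \<in> {0..<T}" for t x
  proof -
    have nrm: "(norm (G t x))\<^sup>2 = (\<Sum>i\<in>UNIV. (G t x $ i)\<^sup>2)"
      by (simp add: norm_vec_def L2_set_def sum_nonneg)
    have "(\<Sum>i\<in>UNIV. u t x * ((G t x $ i)\<^sup>2 / \<epsilon>\<^sup>2 - H t x $ i $ i / \<epsilon>))
        = u t x * ((norm (G t x))\<^sup>2 / \<epsilon>\<^sup>2 - trace (H t x) / \<epsilon>)"
      by (simp add: nrm trace_def sum_subtractf sum_distrib_left[symmetric] sum_divide_distrib[symmetric])
    also have "- u t x * Dt t x / \<epsilon> + \<epsilon> / 2 * \<dots> = u t x / \<epsilon> * (- Dt t x + 1 / 2 * (norm (G t x))\<^sup>2 - \<epsilon> / 2 * trace (H t x))"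
      using \<epsilon> by (simp add: field_simps power2_eq_square)
    also have "\<dots> = 0" using pde[OF that, of x] by simp
    finally show ?thesis .
  qed
  ultimately show ?thesis
    unfolding backward_caloric_def u_def[symmetric]
    by (intro conjI exI[of _ "\<lambda>t x. - u t x * Dt t x / \<epsilon>"] exI[of _ "\<lambda>t x i. - u t x * (G t x $ i) / \<epsilon>"]
        exI[of _ "\<lambda>t x i. u t x * ((G t x $ i)\<^sup>2 / \<epsilon>\<^sup>2 - H t x $ i $ i / \<epsilon>)"] ballI allI) auto
qed

text \<open>Supplies the growth hypothesis of the maximum principle for exp (- \<phi> / \<epsilon>):
  the bounded gradient gives linear decay at most, starting from the minimum over the compact time
  interval of the values at the origin.\<close>

lemma viscous_HJ_lower_bound:
  fixes \<phi> :: "real \<Rightarrow> real ^ 'n \<Rightarrow> real"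
  assumes sol: "viscous_HJ_classical_solution \<epsilon> T g0 \<phi>" and T: "T > 0"
    and g0: "\<And>x. - norm x \<le> g0 x"
  obtains A M where "\<And>t x. t \<in> {0..T} \<Longrightarrow> \<phi> t x \<ge> - A - M * norm x"
proof -
  from sol have cont: "continuous_on ({0..T} \<times> UNIV) (\<lambda>(t, x). \<phi> t x)" and final: "\<And>x. \<phi> T x = g0 x"
    by (simp_all add: viscous_HJ_classical_solution_def)
  from sol obtain G :: "real \<Rightarrow> real ^ 'n \<Rightarrow> real ^ 'n" and M where
    d: "\<And>t x. t \<in> {0..<T} \<Longrightarrow> (\<phi> t has_derivative (\<lambda>v. G t x \<bullet> v)) (at x)"
    and M: "\<And>t x. t \<in> {0..<T} \<Longrightarrow> norm (G t x) \<le> M"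
    unfolding viscous_HJ_classical_solution_def by blast
  have "continuous_on {0..T} (\<lambda>t. \<phi> t 0)"
    using continuous_on_compose2[OF cont, of "{0..T}" "\<lambda>t. (t, 0)"]
    by (force intro: continuous_intros)
  then obtain t0 where t0: "\<And>t. t \<in> {0..T} \<Longrightarrow> \<phi> t0 0 \<le> \<phi> t 0"
    using continuous_attains_inf[of "{0..T}" "\<lambda>t. \<phi> t 0"] T by (auto simp: Bex_def Ball_def)
  show thesis
  proof
    fix t x assume t: "t \<in> {0..T}"
    \<comment> \<open>The gradient bound \<open>M\<close> holds only before \<open>T\<close>; the 1
      in \<open>max M 1\<close> covers the final time, where the slope comes from
      \<open>g0\<close>.\<close>
    show "\<phi> t x \<ge> - \<bar>\<phi> t0 0\<bar> - max M 1 * norm x"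
    proof (cases "t = T")
      case True
      have "1 * norm x \<le> max M 1 * norm x" by (intro mult_right_mono) auto
      thus ?thesis using final[of x] g0[of x] unfolding True by linarith
    next
      case False
      hence t': "t \<in> {0..<T}" using t by auto
      have "norm (\<phi> t 0 - \<phi> t x) \<le> M * norm (0 - x)"
      proof (rule differentiable_bound[of UNIV])
        show "(\<phi> t has_derivative (\<lambda>v. G t y \<bullet> v)) (at y within UNIV)" for y using d[OF t'] by simp
        show "onorm (\<lambda>v. G t y \<bullet> v) \<le> M" for y
        proof (rule onorm_bound)
          show "0 \<le> M" using M[OF t', of y] norm_ge_zero order_trans by blast
          show "norm (G t y \<bullet> v) \<le> M * norm v" for v
            using Cauchy_Schwarz_ineq2[of "G t y" v] mult_right_mono[OF M[OF t', of y], of "norm v"] by simp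
        qed
      qed auto
      moreover have "M * norm x \<le> max M 1 * norm x" by (intro mult_right_mono) auto
      ultimately show ?thesis using t0[OF t] by (simp add: abs_le_iff) linarith
    qed
  qed
qed

text \<open>The product of i (k + 2 (i - 1)) for i from 1 to m, that is, the factor collected when
  the radial generator acts m times on q^m.\<close>

definition heat_norm :: "nat \<Rightarrow> nat \<Rightarrow> real" where
  "heat_norm k m = fact m * 2 ^ m * pochhammer (real k / 2) m"

text \<open>The solution of $\partial_s p = \frac{1}{2} \Delta p$ on $\mathbb{R}^k$ with $p = |x|^{2j}$ at
  $s = 0$, written in $q = |x|^2$. It comes from expanding the exponential of
  $s (2 q \partial_q^2 + k \partial_q)$, whose generator maps $q^m$ to $m (k + 2 (m - 1)) q^{m-1}$.\<close>

definition heat_poly :: "nat \<Rightarrow> nat \<Rightarrow> real \<Rightarrow> real \<Rightarrow> real" where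
  "heat_poly k j s q =
     (\<Sum>m\<le>j. heat_norm k j / (fact (j - m) * heat_norm k m) * s ^ (j - m) * q ^ m)"

lemma heat_norm_Suc: "heat_norm k (Suc m) = heat_norm k m * (real (Suc m) * (real k + 2 * real m))"
  by (simp add: heat_norm_def pochhammer_Suc field_simps)

lemma heat_norm_pos: "k \<ge> 1 \<Longrightarrow> heat_norm k m > 0"
  by (auto simp: heat_norm_def intro!: mult_pos_pos pochhammer_pos)

lemma heat_poly_0_left: "k \<ge> 1 \<Longrightarrow> heat_poly k j 0 q = q ^ j"
  using heat_norm_pos[of k j]
  by (simp add: heat_poly_def power_0_left sum.delta if_distrib cong: if_cong)
     (subst sum.mono_neutral_right[of _ "{j}"]; auto)

text \<open>Only the term with \<open>m = 0\<close> survives at the origin; these values are the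
  numerators in \<open>cosh_heat_series\<close>.\<close>

lemma heat_poly_0_right: "heat_poly k j s 0 = 2 ^ j * pochhammer (real k / 2) j * s ^ j"
  unfolding heat_poly_def
  by (subst sum.mono_neutral_right[of _ "{0}"]) (auto simp: heat_norm_def)

lemma heat_poly_nonneg: "k \<ge> 1 \<Longrightarrow> s \<ge> 0 \<Longrightarrow> q \<ge> 0 \<Longrightarrow> heat_poly k j s q \<ge> 0"
  unfolding heat_poly_def using heat_norm_pos[of k]
  by (intro sum_nonneg mult_nonneg_nonneg divide_nonneg_nonneg) (auto intro: less_imp_le)

text \<open>Wherever the exponent \<open>m - 1\<close> here, or \<open>m - 2\<close> in
  \<open>heat_poly_qq\<close>, is truncated at 0, a factor \<open>real m\<close> or
  \<open>real (m - 1)\<close> vanishes.\<close>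

definition heat_poly_q :: "nat \<Rightarrow> nat \<Rightarrow> real \<Rightarrow> real \<Rightarrow> real" where
  "heat_poly_q k j s q =
     (\<Sum>m\<le>j. heat_norm k j / (fact (j - m) * heat_norm k m) * s ^ (j - m) * (real m * q ^ (m - 1)))"

definition heat_poly_qq :: "nat \<Rightarrow> nat \<Rightarrow> real \<Rightarrow> real \<Rightarrow> real" where
  "heat_poly_qq k j s q =
     (\<Sum>m\<le>j. heat_norm k j / (fact (j - m) * heat_norm k m) * s ^ (j - m) *
        (real m * (real (m - 1) * q ^ (m - 2))))"

lemma DERIV_heat_poly_q:
  "((\<lambda>q. heat_poly k j s q) has_real_derivative heat_poly_q k j s q) (at q)"
  unfolding heat_poly_def heat_poly_q_def
  by (intro DERIV_sum DERIV_cmult) (auto intro!: derivative_eq_intros)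

lemma DERIV_heat_poly_qq:
  "((\<lambda>q. heat_poly_q k j s q) has_real_derivative heat_poly_qq k j s q) (at q)"
  unfolding heat_poly_q_def heat_poly_qq_def
  by (intro DERIV_sum DERIV_cmult) (auto intro!: derivative_eq_intros simp: numeral_2_eq_2)

text \<open>Comparison of coefficients of powers of q: the generator lowers the degree by one, so
  after an index shift the recursion \<open>heat_norm_Suc\<close> matches it with the factor j - m
  coming from the derivative of s^(j-m).\<close>

lemma DERIV_heat_poly_s:
  assumes "k \<ge> 1"
  shows "((\<lambda>s. heat_poly k j s q) has_real_derivative
           2 * q * heat_poly_qq k j s q + real k * heat_poly_q k j s q) (at s)"
proof -
  let ?c = "\<lambda>m. heat_norm k j / (fact (j - m) * heat_norm k m)"
  have "((\<lambda>s. heat_poly k j s q) has_real_derivative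
          (\<Sum>m\<le>j. ?c m * (real (j - m) * s ^ (j - m - 1)) * q ^ m)) (at s)"
    unfolding heat_poly_def
    by (intro DERIV_sum DERIV_cmult_right DERIV_cmult) (auto intro!: derivative_eq_intros)
  moreover have "2 * q * heat_poly_qq k j s q + real k * heat_poly_q k j s q =
     (\<Sum>m\<le>j. ?c m * s ^ (j - m) * (real m * (real k + 2 * real (m - 1)) * q ^ (m - 1)))"
    unfolding heat_poly_q_def heat_poly_qq_def sum_distrib_left sum.distrib[symmetric]
  proof (rule sum.cong[OF refl])
    fix m
    have "real (m - 1) * q ^ (m - 1) = q * (real (m - 1) * q ^ (m - 2))"
    proof (cases "m - 1")
      case (Suc n)
      hence "m - 2 = n" by simp
      thus ?thesis unfolding Suc by simp
    qed simp
    moreover have "2 * q * (C * (x * A)) + K * (C * (x * Q)) = C * (x * (K + 2 * p) * Q)"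
      if "p * Q = q * A" for C x A K Q p :: real
    proof -
      have "2 * q * (C * (x * A)) + K * (C * (x * Q)) = C * x * (2 * (q * A) + K * Q)"
        by (simp add: algebra_simps)
      also have "\<dots> = C * (x * (K + 2 * p) * Q)" unfolding that[symmetric] by (simp add: algebra_simps)
      finally show ?thesis .
    qed
    ultimately show "2 * q * (?c m * s ^ (j - m) * (real m * (real (m - 1) * q ^ (m - 2)))) +
         real k * (?c m * s ^ (j - m) * (real m * q ^ (m - 1))) =
         ?c m * s ^ (j - m) * (real m * (real k + 2 * real (m - 1)) * q ^ (m - 1))"
      by blast
  qed
  moreover have "\<dots> = (\<Sum>m\<le>j. ?c m * (real (j - m) * s ^ (j - m - 1)) * q ^ m)"
  proof (cases j)
    case (Suc n)
    have "(\<Sum>m\<le>j. ?c m * s ^ (j - m) * (real m * (real k + 2 * real (m - 1)) * q ^ (m - 1))) =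
       (\<Sum>m\<le>n. ?c (Suc m) * s ^ (n - m) * (real (Suc m) * (real k + 2 * real m) * q ^ m))"
      unfolding Suc by (subst sum.atMost_Suc_shift) simp
    also have "\<dots> = (\<Sum>m\<le>n. ?c m * (real (j - m) * s ^ (j - m - 1)) * q ^ m)"
    proof (rule sum.cong[OF refl])
      fix m assume "m \<in> {..n}"
      hence jm: "j - m = Suc (n - m)" "j - Suc m = n - m" using Suc by auto
      have "(heat_norm k m :: real) > 0" "real k + 2 * real m > 0" using assms heat_norm_pos by auto
      thus "?c (Suc m) * s ^ (n - m) * (real (Suc m) * (real k + 2 * real m) * q ^ m)
          = ?c m * (real (j - m) * s ^ (j - m - 1)) * q ^ m"
        unfolding jm heat_norm_Suc by (simp add: divide_simps del: of_nat_Suc)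
    qed
    also have "\<dots> = (\<Sum>m\<le>j. ?c m * (real (j - m) * s ^ (j - m - 1)) * q ^ m)"
      unfolding Suc by simp
    finally show ?thesis .
  qed simp
  ultimately show ?thesis by simp
qed

lemma continuous_on_heat_poly [continuous_intros]:
  "continuous_on A f \<Longrightarrow> continuous_on A g \<Longrightarrow> continuous_on A (\<lambda>p. heat_poly k j (f p) (g p))"
  unfolding heat_poly_def by (intro continuous_intros)

text \<open>For q the sum of k squared coordinates, the Laplacian of f(q) is 4 q f'' + 2 k f', twice
  the generator of \<open>heat_poly\<close>. The time \<epsilon> (T - t) accounts for the reversal
  of time and for the viscosity.\<close>

lemma backward_caloric_heat_poly:
  fixes I :: "'n::finite set"
  assumes "k \<ge> 1" "card I = k"
  shows "backward_caloric \<epsilon> T (\<lambda>t (x :: real ^ 'n). heat_poly k j (\<epsilon> * (T - t)) (\<Sum>i\<in>I. (x $ i)\<^sup>2))"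
proof -
  define q where "q = (\<lambda>x :: real ^ 'n. \<Sum>i\<in>I. (x $ i)\<^sup>2)"
  define W1 where "W1 = (\<lambda>t x. heat_poly_q k j (\<epsilon> * (T - t)) (q x))"
  define W2 where "W2 = (\<lambda>t x. heat_poly_qq k j (\<epsilon> * (T - t)) (q x))"
  have q_line: "q (x + r *\<^sub>R axis i 1) = q x + (if i \<in> I then 2 * x $ i * r + r\<^sup>2 else 0)" for x r i
  proof (cases "i \<in> I")
    case True
    have "q y = (\<Sum>j\<in>I - {i}. (y $ j)\<^sup>2) + (y $ i)\<^sup>2" for y
      unfolding q_def using True by (subst sum.remove[of _ i]) auto
    moreover have "(\<Sum>j\<in>I - {i}. ((x + r *\<^sub>R axis i 1) $ j)\<^sup>2) = (\<Sum>j\<in>I - {i}. (x $ j)\<^sup>2)"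
      by (intro sum.cong) (auto simp: axis_def)
    ultimately show ?thesis using True by (simp add: axis_def power2_sum)
  next
    case False
    thus ?thesis unfolding q_def by (auto simp: axis_def intro!: sum.cong)
  qed
  have q_deriv: "((\<lambda>r. q (x + r *\<^sub>R axis i 1)) has_real_derivative (if i \<in> I then 2 * x $ i else 0)) (at 0)"
    for x i unfolding q_line by (auto intro!: derivative_eq_intros)
  have chain: "((\<lambda>r. F (q (x + r *\<^sub>R axis i 1))) has_real_derivative D * (if i \<in> I then 2 * x $ i else 0)) (at 0)"
    if "(F has_real_derivative D) (at (q x))" for F D x i
    using DERIV_chain2[of F D "\<lambda>r. q (x + r *\<^sub>R axis i 1)" 0] that q_deriv[of x i] by simp
  have c: "continuous_on ({0..T} \<times> UNIV) (\<lambda>(t, x). heat_poly k j (\<epsilon> * (T - t)) (q x))"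
    unfolding split_beta q_def by (intro continuous_intros)
  have dt: "((\<lambda>t. heat_poly k j (\<epsilon> * (T - t)) (q x)) has_real_derivative
      (2 * q x * W2 t x + real k * W1 t x) * - \<epsilon>) (at t within {0..<T})" for t x
  proof -
    have "((\<lambda>t. \<epsilon> * (T - t)) has_real_derivative - \<epsilon>) (at t)" by (auto intro!: derivative_eq_intros)
    from DERIV_chain2[OF DERIV_heat_poly_s[OF assms(1)] this, of j "q x"]
    show ?thesis unfolding W1_def W2_def by (rule has_field_derivative_at_within)
  qed
  have d1: "((\<lambda>r. heat_poly k j (\<epsilon> * (T - t)) (q (x + r *\<^sub>R axis i 1))) has_real_derivative
      W1 t x * (if i \<in> I then 2 * x $ i else 0)) (at 0)" for t x i
    unfolding W1_def by (intro chain DERIV_heat_poly_q)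
  have d2: "((\<lambda>r. W1 t (x + r *\<^sub>R axis i 1) * (if i \<in> I then 2 * (x + r *\<^sub>R axis i 1) $ i else 0)) has_real_derivative
      (if i \<in> I then 4 * (x $ i)\<^sup>2 * W2 t x + 2 * W1 t x else 0)) (at 0)" for t x i
  proof (cases "i \<in> I")
    case True
    have "((\<lambda>r. W1 t (x + r *\<^sub>R axis i 1)) has_real_derivative W2 t x * (2 * x $ i)) (at 0)"
      using chain[OF DERIV_heat_poly_qq[of k j "\<epsilon> * (T - t)" "q x"], of i] True unfolding W1_def W2_def by simp
    thus ?thesis using True
      by (auto intro!: derivative_eq_intros simp: power2_eq_square)
  qed simp
  have sum: "(\<Sum>i\<in>UNIV. if i \<in> I then 4 * (x $ i)\<^sup>2 * W2 t x + 2 * W1 t x else 0) =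
      4 * q x * W2 t x + 2 * real k * W1 t x" for t x
    using assms(2)
    by (simp add: sum.If_cases sum.distrib q_def sum_distrib_left[symmetric] sum_distrib_right[symmetric])
  have "backward_caloric \<epsilon> T (\<lambda>t x. heat_poly k j (\<epsilon> * (T - t)) (q x))"
    unfolding backward_caloric_def
  proof (intro conjI c, rule exI[of _ "\<lambda>t x. (2 * q x * W2 t x + real k * W1 t x) * - \<epsilon>"],
      rule exI[of _ "\<lambda>t x i. W1 t x * (if i \<in> I then 2 * x $ i else 0)"],
      rule exI[of _ "\<lambda>t x i. if i \<in> I then 4 * (x $ i)\<^sup>2 * W2 t x + 2 * W1 t x else 0"], intro ballI allI conjI dt d1 d2)
    fix t x
    show "(2 * q x * W2 t x + real k * W1 t x) * - \<epsilon> + \<epsilon> / 2 *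
        (\<Sum>i\<in>UNIV. if i \<in> I then 4 * (x $ i)\<^sup>2 * W2 t x + 2 * W1 t x else 0) = 0"
      unfolding sum by (simp add: algebra_simps)
  qed
  thus ?thesis by (simp only: q_def)
qed

text \<open>Each y^(2m) is at most (2m)! exp y, a single term of the exponential series. This makes
  rate 1 admissible as growth in the maximum principle for the lower bound.\<close>

lemma heat_poly_exp_bound:
  assumes "k \<ge> 1" "S \<ge> 0"
  obtains K where "K > 0" "\<And>s y. 0 \<le> s \<Longrightarrow> s \<le> S \<Longrightarrow> 0 \<le> y \<Longrightarrow> heat_poly k j s (y\<^sup>2) \<le> K * exp y"
proof -
  define K where "K = (\<Sum>m\<le>j. heat_norm k j / (fact (j - m) * heat_norm k m) * S ^ (j - m) * fact (2 * m))"
  have K0: "K \<ge> 0" unfolding K_def using heat_norm_pos[OF assms(1)] assms(2)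
    by (intro sum_nonneg mult_nonneg_nonneg divide_nonneg_nonneg) (auto intro: less_imp_le)
  have "heat_poly k j s (y\<^sup>2) \<le> (K + 1) * exp y" if "0 \<le> s" "s \<le> S" "0 \<le> y" for s y
  proof -
    have e: "(y\<^sup>2) ^ m \<le> fact (2 * m) * exp y" for m
    proof -
      have "y ^ (2 * m) / fact (2 * m) \<le> exp y"
        using sum_le_suminf[OF summable_exp, of "{2 * m}" y] that(3)
        by (simp add: exp_def divide_inverse mult.commute)
      thus ?thesis by (simp add: field_simps flip: power_mult)
    qed
    have "heat_poly k j s (y\<^sup>2) \<le> (\<Sum>m\<le>j. heat_norm k j / (fact (j - m) * heat_norm k m) * S ^ (j - m) * (fact (2 * m) * exp y))"
      unfolding heat_poly_def using heat_norm_pos[OF assms(1)] assms(2) that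
      by (intro sum_mono mult_mono mult_left_mono power_mono e mult_nonneg_nonneg divide_nonneg_nonneg) (auto intro: less_imp_le)
    also have "\<dots> = K * exp y" by (simp add: K_def sum_distrib_right mult.assoc)
    finally show ?thesis by (simp add: distrib_right add_increasing2)
  qed
  thus thesis using that[of "K + 1"] K0 by auto
qed

section \<open>Two-sided bound for the transformed solution\<close>

text \<open>Counting the smaller indices is strictly monotone, hence a bijection from
  \<open>'n\<close> onto the numbers below \<open>CARD('n)\<close>.\<close>

lemma card_first_indices:
  assumes "k \<le> CARD('n :: {finite, linorder})"
  shows "card {i :: 'n. card {j. j < i} < k} = k"
proof -
  let ?r = "\<lambda>i :: 'n. card {j. j < i}"
  have "strict_mono ?r"
    by (intro strict_monoI psubset_card_mono) auto
  hence inj: "inj ?r" by (rule strict_mono_imp_inj_on)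
  have "?r i < CARD('n)" for i by (intro psubset_card_mono) auto
  hence "range ?r \<subseteq> {..<CARD('n)}" by auto
  hence range: "range ?r = {..<CARD('n)}"
    using card_image[OF inj] by (intro card_subset_eq) auto
  have "?r ` {i. ?r i < k} = {..<k}"
  proof
    show "{..<k} \<subseteq> ?r ` {i. ?r i < k}"
    proof
      fix m assume m: "m \<in> {..<k}"
      hence "m \<in> range ?r" unfolding range using assms by auto
      thus "m \<in> ?r ` {i. ?r i < k}" using m by auto
    qed
  qed auto
  moreover have "card (?r ` {i. ?r i < k}) = card {i. ?r i < k}"
    using inj by (intro card_image) (auto simp: inj_on_def)
  ultimately show ?thesis by simp
qed

lemma norm_proj_first_power2:
  "(norm (proj_first k x))\<^sup>2 = (\<Sum>i\<in>{i. card {j. j < i} < k}. (x $ i)\<^sup>2)"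
proof -
  have "(norm (proj_first k x))\<^sup>2 = (\<Sum>i\<in>UNIV. (proj_first k x $ i)\<^sup>2)"
    by (simp add: norm_vec_def L2_set_def sum_nonneg)
  also have "\<dots> = (\<Sum>i\<in>UNIV. if card {j. j < i} < k then (x $ i)\<^sup>2 else 0)"
    by (intro sum.cong) (auto simp: proj_first_def)
  finally show ?thesis by (simp add: sum.If_cases)
qed

lemma norm_proj_first_le: "norm (proj_first k x) \<le> norm x"
proof -
  have "(norm (proj_first k x))\<^sup>2 \<le> (norm x)\<^sup>2"
    unfolding norm_proj_first_power2
    by (simp add: norm_vec_def L2_set_def sum_nonneg sum_mono2)
  thus ?thesis by (rule power2_le_imp_le) simp
qed

lemma cosh_even_sums: "(\<lambda>j. y ^ (2 * j) / fact (2 * j)) sums cosh (y :: real)"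
proof -
  have "(\<lambda>n. if even n then y ^ n /\<^sub>R fact n else 0) sums cosh y" by (rule cosh_converges)
  hence "(\<lambda>j. (\<lambda>n. if even n then y ^ n /\<^sub>R fact n else 0) (2 * j)) sums cosh y"
    by (subst sums_mono_reindex) (auto simp: strict_mono_def elim!: evenE)
  thus ?thesis by (simp add: field_simps)
qed

definition cosh_partial :: "nat \<Rightarrow> real \<Rightarrow> real" where
  "cosh_partial N y = (\<Sum>j\<le>N. y ^ (2 * j) / fact (2 * j))"

lemma cosh_partial_le: "cosh_partial N y \<le> cosh y"
proof -
  have "cosh_partial N y \<le> (\<Sum>j. y ^ (2 * j) / fact (2 * j))"
    unfolding cosh_partial_def
    by (rule sum_le_suminf[OF sums_summable[OF cosh_even_sums]]) auto
  thus ?thesis using sums_unique[OF cosh_even_sums[of y]] by simp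
qed

text \<open>For j > N, y^(2j) = 4^(-j) (2y)^(2j) <= 4^(-N) (2y)^(2j). The tail thus gets a factor
  tending to 0 while its exponential rate stays the same for all N, so one penalty serves every
  truncation.\<close>

lemma cosh_le_partial: "cosh y \<le> cosh_partial N y + (1 / 4) ^ N * cosh (2 * y)"
proof (rule sums_le)
  show "(\<lambda>j. y ^ (2 * j) / fact (2 * j)) sums cosh y" by (rule cosh_even_sums)
  show "(\<lambda>j. (if j \<in> {..N} then y ^ (2 * j) / fact (2 * j) else 0) + (1 / 4) ^ N * ((2 * y) ^ (2 * j) / fact (2 * j)))
      sums (cosh_partial N y + (1 / 4) ^ N * cosh (2 * y))"
    unfolding cosh_partial_def by (intro sums_add sums_If_finite_set sums_mult cosh_even_sums) auto
  fix j
  show "y ^ (2 * j) / fact (2 * j) \<le>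
     (if j \<in> {..N} then y ^ (2 * j) / fact (2 * j) else 0) + (1 / 4) ^ N * ((2 * y) ^ (2 * j) / fact (2 * j))"
  proof (cases "j \<le> N")
    case False
    have "(4 :: real) ^ N \<le> 4 ^ j" using False by (intro power_increasing) auto
    hence "1 \<le> (1 / 4) ^ N * (4 :: real) ^ j" by (simp add: power_one_over field_simps)
    hence "1 * (y ^ (2 * j) / fact (2 * j)) \<le> (1 / 4) ^ N * 4 ^ j * (y ^ (2 * j) / fact (2 * j))"
      by (rule mult_right_mono) auto
    thus ?thesis using False by (simp add: power_mult power_mult_distrib)
  qed auto
qed

context
  fixes k :: nat and \<epsilon> T :: real and \<phi> :: "real \<Rightarrow> real ^ 'n::{finite, linorder} \<Rightarrow> real"
  assumes k: "1 \<le> k" "k \<le> CARD('n)" and \<epsilon>: "\<epsilon> > 0" and T: "T > 0"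
    and sol: "viscous_HJ_classical_solution \<epsilon> T (\<lambda>x. - norm (proj_first k x)) \<phi>"
begin

text \<open>The weights are the Taylor coefficients of cosh (r / \<epsilon>) in r^2, each power
  r^(2j) being replaced by its heat polynomial.\<close>

definition truncated_cosh_flow :: "nat \<Rightarrow> real \<Rightarrow> (real, 'n) vec \<Rightarrow> real" where
  "truncated_cosh_flow N t x =
     (\<Sum>j\<le>N. 1 / (\<epsilon> ^ (2 * j) * fact (2 * j)) * heat_poly k j (\<epsilon> * (T - t)) ((norm (proj_first k x))\<^sup>2))"

lemma truncated_cosh_flow_caloric: "backward_caloric \<epsilon> T (truncated_cosh_flow N)"
proof -
  have "backward_caloric \<epsilon> T (\<lambda>t x. \<Sum>j\<le>N. 1 / (\<epsilon> ^ (2 * j) * fact (2 * j)) * heat_poly k j (\<epsilon> * (T - t)) (\<Sum>i\<in>{i :: 'n. card {j. j < i} < k}. (x $ i)\<^sup>2))"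
    by (intro backward_caloric_sum backward_caloric_cmult backward_caloric_heat_poly card_first_indices k)
  thus ?thesis unfolding truncated_cosh_flow_def[abs_def] norm_proj_first_power2 .
qed

lemma truncated_cosh_flow_nonneg: "t \<le> T \<Longrightarrow> truncated_cosh_flow N t x \<ge> 0"
  unfolding truncated_cosh_flow_def using \<epsilon> k
  by (intro sum_nonneg mult_nonneg_nonneg heat_poly_nonneg) auto

lemma truncated_cosh_flow_final: "truncated_cosh_flow N T x = cosh_partial N (norm (proj_first k x) / \<epsilon>)"
  unfolding truncated_cosh_flow_def cosh_partial_def
  by (intro sum.cong) (auto simp: heat_poly_0_left[OF k(1)] power_divide power_mult)

text \<open>The weight \<epsilon>^(-2j) meets \<epsilon>^j (T - t)^j from the heat polynomial, which
  leaves the single variable (T - t) / \<epsilon>.\<close>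

lemma truncated_cosh_flow_origin:
  "truncated_cosh_flow N t 0 = (\<Sum>j\<le>N. 2 ^ j * pochhammer (real k / 2) j * ((T - t) / \<epsilon>) ^ j / fact (2 * j))"
proof -
  have "(norm (proj_first k (0 :: (real, 'n) vec)))\<^sup>2 = 0" by (simp add: norm_proj_first_power2)
  thus ?thesis unfolding truncated_cosh_flow_def
    using \<epsilon> by (intro sum.cong) (auto simp: heat_poly_0_right power_divide power_mult_distrib mult_2 power_add)
qed

lemma truncated_cosh_flow_growth:
  obtains K where "K > 0" "\<And>t x. t \<in> {0..T} \<Longrightarrow> truncated_cosh_flow N t x \<le> K * exp (norm x)"
proof -
  have "\<exists>K. K > 0 \<and> (\<forall>s y. 0 \<le> s \<longrightarrow> s \<le> \<epsilon> * T \<longrightarrow> 0 \<le> y \<longrightarrow> heat_poly k j s (y\<^sup>2) \<le> K * exp y)" for j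
    using heat_poly_exp_bound[OF k(1), of "\<epsilon> * T" j] \<epsilon> T by (metis less_eq_real_def mult_nonneg_nonneg)
  then obtain K where K: "\<And>j. K j > 0"
    "\<And>j s y. 0 \<le> s \<Longrightarrow> s \<le> \<epsilon> * T \<Longrightarrow> 0 \<le> y \<Longrightarrow> heat_poly k j s (y\<^sup>2) \<le> K j * exp y"
    by metis
  let ?K = "\<Sum>j\<le>N. 1 / (\<epsilon> ^ (2 * j) * fact (2 * j)) * K j"
  show thesis
  proof
    show "?K > 0" using \<epsilon> K(1) by (intro sum_pos) auto
    fix t and x :: "(real, 'n) vec" assume t: "t \<in> {0..T}"
    have "truncated_cosh_flow N t x \<le> (\<Sum>j\<le>N. 1 / (\<epsilon> ^ (2 * j) * fact (2 * j)) * (K j * exp (norm x)))"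
      unfolding truncated_cosh_flow_def
    proof (intro sum_mono mult_left_mono)
      fix j
      have "heat_poly k j (\<epsilon> * (T - t)) ((norm (proj_first k x))\<^sup>2) \<le> K j * exp (norm (proj_first k x))"
        using t \<epsilon> by (intro K(2)) auto
      also have "\<dots> \<le> K j * exp (norm x)"
        using less_imp_le[OF K(1)] norm_proj_first_le by (intro mult_left_mono) auto
      finally show "heat_poly k j (\<epsilon> * (T - t)) ((norm (proj_first k x))\<^sup>2) \<le> K j * exp (norm x)" .
    qed (use \<epsilon> in auto)
    thus "truncated_cosh_flow N t x \<le> ?K * exp (norm x)" by (simp add: sum_distrib_right mult.assoc)
  qed
qed

text \<open>The maximum principle is applied to u minus twice the truncated flow. At the final time
  this difference is at most twice the cosh tail, so \<eta> = 2 (1/4)^N is admissible, and N tends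
  to infinity.\<close>

lemma exp_viscous_solution_upper:
  assumes t: "t \<in> {0..T}"
  shows "exp (- \<phi> t 0 / \<epsilon>) \<le> 2 * cosh_heat_series k ((T - t) / \<epsilon>)"
proof -
  let ?u = "\<lambda>t x. exp (- \<phi> t x / \<epsilon>)"
  obtain A M where AM: "\<And>t x. t \<in> {0..T} \<Longrightarrow> \<phi> t x \<ge> - A - M * norm x"
    using viscous_HJ_lower_bound[OF sol T] norm_proj_first_le by (metis neg_le_iff_le)
  \<comment> \<open>Must exceed the growth rate M / \<epsilon> of u strictly and be at least the
    rate 2 / \<epsilon> of the truncation error.\<close>
  define b where "b = max (2 / \<epsilon>) (M / \<epsilon> + 1)"
  \<comment> \<open>Independent of \<open>N\<close>, so the error \<open>C * (1 / 4) ^ N\<close>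
    vanishes in the limit.\<close>
  define C where "C = 4 * (exp (\<epsilon> * (real CARD('n) * b)\<^sup>2 * (T - t)) * cosh_gauge b (0 :: (real, 'n) vec))"
  have b: "b > 0" "M / \<epsilon> < b" "2 / \<epsilon> \<le> b" using \<epsilon> by (auto simp: b_def less_max_iff_disj)
  have *: "?u t 0 \<le> 2 * cosh_heat_series k ((T - t) / \<epsilon>) + C * (1 / 4) ^ N" for N
  proof -
    let ?w = "\<lambda>t x. ?u t x + (- 2) * truncated_cosh_flow N t x"
    have "?w t 0 \<le> 2 * (2 * (1 / 4) ^ N) * exp (\<epsilon> * (real CARD('n) * b)\<^sup>2 * (T - t)) * cosh_gauge b (0 :: (real, 'n) vec)"
    proof (rule backward_caloric_maximum_principle[where w = ?w and C = "M / \<epsilon>" and K = "exp (A / \<epsilon>)"])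
      show "backward_caloric \<epsilon> T ?w"
        by (intro backward_caloric_add backward_caloric_cmult truncated_cosh_flow_caloric
            backward_caloric_Cole_Hopf[OF sol \<epsilon>])
      show "?w s x \<le> exp (A / \<epsilon>) * exp (M / \<epsilon> * norm x)" if s: "s \<in> {0..T}" for s x
      proof -
        have "- \<phi> s x / \<epsilon> \<le> (A + M * norm x) / \<epsilon>"
          using AM[OF s, of x] \<epsilon> by (intro divide_right_mono) auto
        hence "?u s x \<le> exp (A / \<epsilon> + M / \<epsilon> * norm x)" by (simp add: add_divide_distrib)
        thus ?thesis using truncated_cosh_flow_nonneg[of s N x] s by (simp add: exp_add)
      qed
      show "?w T x \<le> 2 * (1 / 4) ^ N * exp (b * norm x)" for x
      proof -
        let ?y = "norm (proj_first k x) / \<epsilon>"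
        have y: "?y \<ge> 0" using \<epsilon> by simp
        have "\<phi> T x = - norm (proj_first k x)" using sol by (simp add: viscous_HJ_classical_solution_def)
        hence "?u T x = exp ?y" by simp
        also have "\<dots> \<le> 2 * cosh ?y" by (simp add: cosh_def)
        finally have "?w T x \<le> 2 * (cosh ?y - cosh_partial N ?y)" by (simp add: truncated_cosh_flow_final)
        also have "\<dots> \<le> 2 * ((1 / 4) ^ N * cosh (2 * ?y))" using cosh_le_partial[of ?y N] by simp
        also have "\<dots> \<le> 2 * ((1 / 4) ^ N * exp (b * norm x))"
        proof (intro mult_left_mono)
          have "exp (- (2 * ?y)) \<le> exp (2 * ?y)" using y by simp
          hence "cosh (2 * ?y) \<le> exp (2 * ?y)" by (simp add: cosh_def)
          also have "2 * ?y \<le> 2 / \<epsilon> * norm x" using \<epsilon> norm_proj_first_le[of k x] by (simp add: divide_right_mono)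
          also have "\<dots> \<le> b * norm x" using b by (intro mult_right_mono) auto
          finally show "cosh (2 * ?y) \<le> exp (b * norm x)" by simp
        qed auto
        finally show ?thesis by simp
      qed
    qed (use b \<epsilon> t in auto)
    moreover have "truncated_cosh_flow N t 0 \<le> cosh_heat_series k ((T - t) / \<epsilon>)"
      unfolding truncated_cosh_flow_origin cosh_heat_series_def using t \<epsilon> k
      by (intro sum_le_suminf summable_cosh_heat_series) (auto intro!: divide_nonneg_nonneg mult_nonneg_nonneg pochhammer_nonneg)
    ultimately show ?thesis by (simp add: C_def mult_ac)
  qed
  have "(\<lambda>N. 2 * cosh_heat_series k ((T - t) / \<epsilon>) + C * (1 / 4) ^ N) \<longlonglongrightarrow>
      2 * cosh_heat_series k ((T - t) / \<epsilon>) + C * 0"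
    by (intro tendsto_intros LIMSEQ_power_zero) auto
  from LIMSEQ_le_const[OF this, of "?u t 0"] * show ?thesis by auto
qed

text \<open>Truncation only lowers cosh, and 2 cosh y - 1 - exp y = exp (- y) - 1 <= 0 for y >= 0,
  so the final data are already ordered. Hence every \<eta> > 0 is admissible with the fixed rates 1
  < 2, and \<eta> tends to 0.\<close>

lemma exp_viscous_solution_lower:
  assumes t: "t \<in> {0..T}"
  shows "2 * cosh_heat_series k ((T - t) / \<epsilon>) - 1 \<le> exp (- \<phi> t 0 / \<epsilon>)"
proof -
  let ?u = "\<lambda>t x. exp (- \<phi> t x / \<epsilon>)"
  define C where "C = 2 * (exp (\<epsilon> * (real CARD('n) * 2)\<^sup>2 * (T - t)) * cosh_gauge 2 (0 :: (real, 'n) vec))"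
  have *: "2 * truncated_cosh_flow N t 0 - 1 \<le> ?u t 0" for N
  proof -
    let ?w = "\<lambda>t x. 2 * truncated_cosh_flow N t x + (- 1 + (- 1) * ?u t x)"
    obtain K where K: "K > 0" "\<And>t x. t \<in> {0..T} \<Longrightarrow> truncated_cosh_flow N t x \<le> K * exp (norm x)"
      using truncated_cosh_flow_growth[where N = N] by blast
    have "?w t 0 \<le> \<eta> * C" if \<eta>: "\<eta> > 0" for \<eta>
    proof -
      have "?w t 0 \<le> 2 * \<eta> * exp (\<epsilon> * (real CARD('n) * 2)\<^sup>2 * (T - t)) * cosh_gauge 2 (0 :: (real, 'n) vec)"
      proof (rule backward_caloric_maximum_principle[where w = ?w and C = 1 and K = "2 * K"])
        show "backward_caloric \<epsilon> T ?w"
          by (intro backward_caloric_add backward_caloric_cmult backward_caloric_const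
              truncated_cosh_flow_caloric backward_caloric_Cole_Hopf[OF sol \<epsilon>])
        show "?w s x \<le> 2 * K * exp (1 * norm x)" if s: "s \<in> {0..T}" for s x
        proof -
          have "?w s x \<le> 2 * truncated_cosh_flow N s x"
            using exp_ge_zero[of "- \<phi> s x / \<epsilon>"] by linarith
          also have "\<dots> \<le> 2 * K * exp (1 * norm x)" using K(2)[OF s, of x] by simp
          finally show ?thesis .
        qed
        show "?w T x \<le> \<eta> * exp (2 * norm x)" for x
        proof -
          let ?y = "norm (proj_first k x) / \<epsilon>"
          have "\<phi> T x = - norm (proj_first k x)" using sol by (simp add: viscous_HJ_classical_solution_def)
          hence "?w T x \<le> 2 * cosh ?y - 1 - exp ?y"
            using cosh_partial_le[of N ?y] by (simp add: truncated_cosh_flow_final)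
          also have "\<dots> = exp (- ?y) - 1" by (simp add: cosh_def add_divide_distrib)
          also have "\<dots> \<le> 0" using \<epsilon> by simp
          also have "0 \<le> \<eta> * exp (2 * norm x)" using \<eta> by simp
          finally show ?thesis .
        qed
      qed (use K \<epsilon> t \<eta> in auto)
      thus ?thesis by (simp add: C_def mult_ac)
    qed
    hence "\<forall>\<^sub>F \<eta> in at_right 0. ?w t 0 \<le> \<eta> * C"
      using eventually_at_right_less[of "0 :: real"] by (auto elim: eventually_mono)
    moreover have "((\<lambda>\<eta>. \<eta> * C) \<longlongrightarrow> 0 * C) (at_right 0)" by (intro tendsto_intros)
    ultimately have "?w t 0 \<le> 0 * C"
      by (intro tendsto_lowerbound[of "\<lambda>\<eta>. \<eta> * C" _ "at_right 0"]) auto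
    thus ?thesis by simp
  qed
  have "cosh_heat_series k ((T - t) / \<epsilon>) \<le> (?u t 0 + 1) / 2"
    unfolding cosh_heat_series_def
  proof (rule suminf_le_const[OF summable_cosh_heat_series[OF k(1)]])
    fix N
    have "(\<Sum>j<N. 2 ^ j * pochhammer (real k / 2) j * ((T - t) / \<epsilon>) ^ j / fact (2 * j))
        \<le> truncated_cosh_flow N t 0"
      unfolding truncated_cosh_flow_origin using t \<epsilon> k
      by (intro sum_mono2) (auto intro!: divide_nonneg_nonneg mult_nonneg_nonneg pochhammer_nonneg)
    thus "(\<Sum>j<N. 2 ^ j * pochhammer (real k / 2) j * ((T - t) / \<epsilon>) ^ j / fact (2 * j)) \<le> (?u t 0 + 1) / 2"
      using *[of N] by simp
  qed
  thus ?thesis by simp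
qed

end

section \<open>The first-order equation\<close>

text \<open>Replaces compactness in both viscosity comparisons: the quadratic and the 1 / t terms
  confine the set where f is positive to a compact set away from time 0, and \<open>final\<close>
  excludes time T.\<close>

lemma penalized_max_interior:
  fixes f :: "real \<times> (real ^ 'n) \<Rightarrow> real"
  assumes cont: "continuous_on ({0<..T} \<times> UNIV) f" and pos: "\<delta> > 0" "K > 0"
    and bound: "\<And>t x. t \<in> {0<..T} \<Longrightarrow> f (t, x) \<le> K * (1 + norm x) - \<delta> * (norm x)\<^sup>2 - \<delta> / t"
    and final: "\<And>x. f (T, x) \<le> 0" and start: "t1 \<in> {0<..T}" "f (t1, x1) > 0"
  obtains t0 x0 where "t0 \<in> {0<..<T}" "\<And>t x. t \<in> {0<..T} \<Longrightarrow> f (t, x) \<le> f (t0, x0)"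
proof -
  \<comment> \<open>For |x| > R, both |x| > 1 and 2 K < \<delta> |x| hold, so K (1 + |x|) <= 2 K |x|
    <= \<delta> |x|^2.\<close>
  define R where "R = 1 + 2 * K / \<delta>"
  \<comment> \<open>Where f > 0 and |x| <= R, \<delta> / t is below K (1 + R).\<close>
  define \<tau> where "\<tau> = \<delta> / (K * (1 + R))"
  have R: "R \<ge> 1" using pos by (simp add: R_def)
  have \<tau>: "\<tau> > 0" using pos R by (simp add: \<tau>_def)
  have inside: "norm x \<le> R \<and> \<tau> \<le> t" if "t \<in> {0<..T}" "f (t, x) > 0" for t x
  proof -
    have b: "\<delta> * (norm x)\<^sup>2 + \<delta> / t < K * (1 + norm x)" using bound[OF that(1), of x] that(2) by linarith
    have t: "\<delta> / t > 0" using that pos by simp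
    have xR: "norm x \<le> R"
    proof (rule ccontr)
      assume "\<not> norm x \<le> R"
      moreover have "2 * K / \<delta> < R" by (simp add: R_def)
      ultimately have n: "norm x > 1" "norm x > 2 * K / \<delta>" using R by linarith+
      have "K * (1 + norm x) \<le> K * (2 * norm x)" using n pos by (intro mult_left_mono) auto
      also have "\<dots> = 2 * K * norm x" by simp
      also have "\<dots> \<le> \<delta> * norm x * norm x"
        using n pos by (intro mult_right_mono) (auto simp: field_simps)
      also have "\<dots> = \<delta> * (norm x)\<^sup>2" by (simp add: power2_eq_square)
      finally show False using b t by linarith
    qed
    have "\<delta> / t \<le> K * (1 + norm x)" using b pos by (smt (verit) mult_nonneg_nonneg zero_le_power2)
    also have "\<dots> \<le> K * (1 + R)" using xR pos by (intro mult_left_mono) auto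
    finally have "\<delta> \<le> K * (1 + R) * t" using that by (simp add: pos_divide_le_eq)
    moreover have "K * (1 + R) > 0" using pos R by simp
    ultimately show ?thesis using xR by (simp add: \<tau>_def pos_divide_le_eq mult.commute)
  qed
  have sub: "{\<tau>..T} \<times> cball 0 R \<subseteq> {0<..T} \<times> (UNIV :: (real ^ 'n) set)" using \<tau> by auto
  have "\<exists>p\<in>{\<tau>..T} \<times> cball 0 R. \<forall>q\<in>{\<tau>..T} \<times> cball 0 R. f q \<le> f p"
  proof (rule continuous_attains_sup)
    show "compact ({\<tau>..T} \<times> cball (0 :: real ^ 'n) R)" by (intro compact_Times) auto
    have "(t1, x1) \<in> {\<tau>..T} \<times> cball 0 R" using inside[OF start] start by simp
    thus "{\<tau>..T} \<times> cball (0 :: real ^ 'n) R \<noteq> {}" by blast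
    show "continuous_on ({\<tau>..T} \<times> cball 0 R) f" by (rule continuous_on_subset[OF cont sub])
  qed
  then obtain t0 x0 where p: "(t0, x0) \<in> {\<tau>..T} \<times> cball 0 R"
    and max: "\<And>q. q \<in> {\<tau>..T} \<times> cball 0 R \<Longrightarrow> f q \<le> f (t0, x0)" by (metis surj_pair)
  have f0: "f (t0, x0) > 0" using max[of "(t1, x1)"] inside[OF start] start by simp
  show thesis
  proof
    show "t0 \<in> {0<..<T}" using p \<tau> f0 final[of x0] by (cases "t0 = T") auto
    show "f (t, x) \<le> f (t0, x0)" if "t \<in> {0<..T}" for t x
      using max[of "(t, x)"] inside[OF that, of x] f0 that by (cases "f (t, x) > 0") auto
  qed
qed

text \<open>The rate 4 lets the time derivative of the penalty dominate the cross term between its gradient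
  and that of the test function; \<open>1 / t\<close> keeps maximum points away from the initial time.\<close>

definition penalty :: "real \<Rightarrow> real \<Rightarrow> real ^ 'n \<Rightarrow> real" where
  "penalty T t x = (1 + x \<bullet> x) * exp (4 * (T - t)) + 1 / t"

text \<open>\<open>c\<close> has no sign: the upper comparison adds the penalty to the barrier, the
  lower one subtracts it.\<close>

lemma C1_test_function_add_penalty:
  fixes \<psi> :: "real \<Rightarrow> real ^ 'n \<Rightarrow> real"
  assumes "C1_test_function T \<psi> Dt G"
  shows "C1_test_function T (\<lambda>t x. \<psi> t x + c * penalty T t x)
     (\<lambda>t x. Dt t x - c * (4 * (1 + x \<bullet> x) * exp (4 * (T - t)) + 1 / t\<^sup>2))
     (\<lambda>t x. G t x + (2 * c * exp (4 * (T - t))) *\<^sub>R x)"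
  unfolding C1_test_function_def
proof (intro conjI ballI allI)
  fix t and x :: "real ^ 'n" assume t: "t \<in> {0<..<T}"
  have "((\<lambda>p. penalty T (fst p) (snd p)) has_derivative
      (\<lambda>p. - (4 * (1 + x \<bullet> x) * exp (4 * (T - t)) + 1 / t\<^sup>2) * fst p + ((2 * exp (4 * (T - t))) *\<^sub>R x) \<bullet> snd p)) (at (t, x))"
    unfolding penalty_def using t
    by (auto intro!: derivative_eq_intros ext simp: inner_commute power2_eq_square field_simps)
  note D = has_derivative_add[OF assms[unfolded C1_test_function_def, THEN conjunct1, rule_format, OF t, of x]
      has_derivative_mult_right[OF this, of c]]
  show "((\<lambda>(t, x). \<psi> t x + c * penalty T t x) has_derivative
     (\<lambda>(h, v). (Dt t x - c * (4 * (1 + x \<bullet> x) * exp (4 * (T - t)) + 1 / t\<^sup>2)) * h +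
        (G t x + (2 * c * exp (4 * (T - t))) *\<^sub>R x) \<bullet> v)) (at (t, x))"
    unfolding split_beta
    by (rule has_derivative_eq_rhs[OF D[unfolded split_beta]])
       (auto simp: fun_eq_iff inner_add_left algebra_simps)
next
  have "continuous_on ({0<..<T} \<times> UNIV) (\<lambda>p. Dt (fst p) (snd p))" "continuous_on ({0<..<T} \<times> UNIV) (\<lambda>p. G (fst p) (snd p))"
    using assms by (auto simp: C1_test_function_def split_beta)
  thus "continuous_on ({0<..<T} \<times> UNIV) (\<lambda>(t, x). Dt t x - c * (4 * (1 + x \<bullet> x) * exp (4 * (T - t)) + 1 / t\<^sup>2))"
    "continuous_on ({0<..<T} \<times> UNIV) (\<lambda>(t, x). G t x + (2 * c * exp (4 * (T - t))) *\<^sub>R x)"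
    unfolding split_beta by (auto intro!: continuous_intros)
qed

text \<open>The upper barrier. Its gradient has length 1 and its time derivative is 1/2, so it
  solves the equation exactly.\<close>

lemma C1_test_function_affine:
  "C1_test_function T (\<lambda>t (x :: real ^ 'n). - x $ i - (T - t) / 2) (\<lambda>t x. 1 / 2) (\<lambda>t x. - axis i 1)"
  unfolding C1_test_function_def split_beta cart_eq_inner_axis
  by (auto intro!: derivative_eq_intros ext continuous_intros simp: inner_commute)

text \<open>The lower barrier. The norm is not differentiable at the origin, precisely where the
  value is wanted; smoothing makes the gradient shorter than 1, which gives a subsolution.\<close>

lemma C1_test_function_smoothed_norm:
  assumes "\<delta> > 0"
  shows "C1_test_function T (\<lambda>t (x :: real ^ 'n). - sqrt (\<delta>\<^sup>2 + x \<bullet> x) - (T - t) / 2)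
     (\<lambda>t x. 1 / 2) (\<lambda>t x. - (1 / sqrt (\<delta>\<^sup>2 + x \<bullet> x)) *\<^sub>R x)"
proof -
  have p: "\<delta>\<^sup>2 + x \<bullet> x > 0" for x :: "real ^ 'n" using assms by (intro add_pos_nonneg) auto
  hence nz: "\<delta>\<^sup>2 + x \<bullet> x \<noteq> 0" for x :: "real ^ 'n" by (metis less_irrefl)
  show ?thesis
    unfolding C1_test_function_def split_beta
  proof (intro conjI ballI allI)
    fix t x
    show "((\<lambda>p. - sqrt (\<delta>\<^sup>2 + snd p \<bullet> snd p) - (T - fst p) / 2) has_derivative
        (\<lambda>p. 1 / 2 * fst p + (- (1 / sqrt (\<delta>\<^sup>2 + x \<bullet> x)) *\<^sub>R x) \<bullet> snd p)) (at (t, x :: real ^ 'n))"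
      by (rule derivative_eq_intros p | simp add: p)+
         (auto simp: inner_commute field_simps p)
  qed (auto intro!: continuous_intros simp: nz)
qed

lemma penalty_ge:
  fixes x :: "real ^ 'n"
  assumes "t \<in> {0<..T}" "\<delta> > 0"
  shows "\<delta> * penalty T t x \<ge> \<delta> * (norm x)\<^sup>2 + \<delta> / t"
proof -
  have "(norm x)\<^sup>2 * 1 \<le> (1 + x \<bullet> x) * exp (4 * (T - t))"
    using assms by (intro mult_mono) (auto simp: power2_norm_eq_inner)
  hence "(norm x)\<^sup>2 + 1 / t \<le> penalty T t x" by (simp add: penalty_def)
  hence "\<delta> * ((norm x)\<^sup>2 + 1 / t) \<le> \<delta> * penalty T t x" using assms by (intro mult_left_mono) auto
  thus ?thesis by (simp add: distrib_left)
qed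

lemma eventually_interior:
  fixes T :: real
  assumes "t0 \<in> {0<..<T}" "\<And>t x. t \<in> {0<..T} \<Longrightarrow> P t x"
  shows "\<forall>\<^sub>F (s, y) in nhds (t0, x0 :: real ^ 'n). P s y"
proof -
  have "open ({0<..<T} \<times> (UNIV :: (real ^ 'n) set))" by (intro open_Times) auto
  hence "\<forall>\<^sub>F p in nhds (t0, x0). p \<in> {0<..<T} \<times> UNIV"
    using assms(1) by (intro eventually_nhds_in_open) auto
  thus ?thesis by eventually_elim (use assms(2) in auto)
qed

context
  fixes T :: real and g :: "real ^ 'n \<Rightarrow> real" and \<phi> :: "real \<Rightarrow> real ^ 'n \<Rightarrow> real" and i :: 'n
  assumes sol: "HJ_Lipschitz_viscosity_solution T g \<phi>" and T: "T > 0"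
    and g_lower: "\<And>x. - norm x \<le> g x" and g_upper: "\<And>x. g x \<le> - x $ i"
begin

text \<open>Lipschitz continuity and \<open>g 0 = 0\<close> give linear growth. The extra
  \<open>norm x\<close> and \<open>T\<close> on the left absorb the terms of the affine barrier when
  \<open>penalized_max_interior\<close> is applied.\<close>

lemma viscosity_growth:
  obtains K where "K > 0" "\<And>t x. t \<in> {0<..T} \<Longrightarrow> \<bar>\<phi> t x\<bar> + norm x + T \<le> K * (1 + norm x)"
proof -
  from sol obtain L where L: "L-lipschitz_on ({0..T} \<times> UNIV) (\<lambda>(t, x). \<phi> t x)"
    and final: "\<And>x. \<phi> T x = g x"
    by (auto simp: HJ_Lipschitz_viscosity_solution_def)
  have L0: "L \<ge> 0" using L by (rule lipschitz_on_nonneg)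
  have "g 0 = 0" using g_lower[of 0] g_upper[of 0] by simp
  have "\<bar>\<phi> t x\<bar> + norm x + T \<le> (L * T + L + 1 + T) * (1 + norm x)" if "t \<in> {0<..T}" for t x
  proof -
    have "dist (\<phi> t x) (\<phi> T 0) \<le> L * dist (t, x) (T, 0)"
      using lipschitz_onD[OF L, of "(t, x)" "(T, 0)"] that T by simp
    moreover have "dist (t, x) (T, 0) \<le> T + norm x"
    proof -
      have "dist (t, x) (T, 0) = norm (t - T, x)" by (simp add: dist_norm)
      also have "\<dots> \<le> norm (t - T) + norm x" by (rule norm_Pair_le)
      finally show ?thesis using that by simp
    qed
    hence "L * dist (t, x) (T, 0) \<le> L * (T + norm x)" using L0 by (rule mult_left_mono)
    ultimately have "\<bar>\<phi> t x\<bar> \<le> L * (T + norm x)" using final[of 0] \<open>g 0 = 0\<close> by (simp add: dist_real_def)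
    moreover have "0 \<le> L * T * norm x" "0 \<le> T * norm x" using L0 T by auto
    moreover have "(L * T + L + 1 + T) * (1 + norm x) =
        L * T + L + 1 + T + L * T * norm x + L * norm x + norm x + T * norm x"
      by (simp add: algebra_simps)
    ultimately show ?thesis using L0 unfolding distrib_left by linarith
  qed
  moreover have "L * T + L + 1 + T > 0" using L0 T by (simp add: add_nonneg_pos add_pos_pos)
  ultimately show thesis using that by blast
qed

lemma viscosity_continuous: "continuous_on ({0<..T} \<times> UNIV) (\<lambda>p. \<phi> (fst p) (snd p))"
proof -
  from sol obtain L where "L-lipschitz_on ({0..T} \<times> UNIV) (\<lambda>(t, x). \<phi> t x)"
    by (auto simp: HJ_Lipschitz_viscosity_solution_def)
  hence "continuous_on ({0..T} \<times> UNIV) (\<lambda>(t, x). \<phi> t x)" by (rule lipschitz_on_continuous_on)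
  thus ?thesis unfolding split_beta by (rule continuous_on_subset) auto
qed

text \<open>Adding the penalty turns the affine solution into a strict supersolution, so the
  subsolution property fails at an interior maximum of the difference. The quadratic term of the
  squared gradient has the favourable sign here.\<close>

lemma viscosity_upper:
  assumes t: "t \<in> {0<..T}" and \<delta>: "\<delta> > 0"
  shows "\<phi> t x \<le> - x $ i - (T - t) / 2 + \<delta> * penalty T t x"
proof (rule ccontr)
  let ?\<Psi> = "\<lambda>t x. - x $ i - (T - t) / 2 + \<delta> * penalty T t x"
  define f where "f = (\<lambda>p. \<phi> (fst p) (snd p) - ?\<Psi> (fst p) (snd p))"
  assume "\<not> ?thesis"
  hence start: "f (t, x) > 0" by (simp add: f_def)
  obtain K where K: "K > 0" "\<And>t x. t \<in> {0<..T} \<Longrightarrow> \<bar>\<phi> t x\<bar> + norm x + T \<le> K * (1 + norm x)"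
    using viscosity_growth by blast
  have cont: "continuous_on ({0<..T} \<times> UNIV) f"
    unfolding f_def penalty_def by (auto intro!: continuous_intros viscosity_continuous)
  have bound: "f (s, y) \<le> K * (1 + norm y) - \<delta> * (norm y)\<^sup>2 - \<delta> / s" if "s \<in> {0<..T}" for s y
  proof -
    have s: "0 < s" "s \<le> T" using that by auto
    have arith: "a - (- b - (T - s) / 2 + P) \<le> Q - R - U"
      if "A + n + T \<le> Q" "R + U \<le> P" "\<bar>b\<bar> \<le> n" "a \<le> A" for a b n A P Q R U :: real
      using that s by argo
    show ?thesis unfolding f_def fst_conv snd_conv
      by (rule arith[OF K(2)[OF that] penalty_ge[OF that \<delta>] component_le_norm_cart abs_ge_self])
  qed
  have final: "f (T, y) \<le> 0" for y
  proof -
    have "\<phi> T y = g y" using sol by (simp add: HJ_Lipschitz_viscosity_solution_def)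
    moreover have "\<delta> * penalty T T y \<ge> 0" using \<delta> T by (simp add: penalty_def)
    ultimately show ?thesis using g_upper[of y] by (simp add: f_def)
  qed
  obtain t0 x0 where t0: "t0 \<in> {0<..<T}" and max: "\<And>s y. s \<in> {0<..T} \<Longrightarrow> f (s, y) \<le> f (t0, x0)"
    using penalized_max_interior[OF cont \<delta> K(1) bound final t start] by blast
  let ?E = "exp (4 * (T - t0))"
  let ?G = "- axis i 1 + (2 * \<delta> * ?E) *\<^sub>R x0"
  have test: "C1_test_function T ?\<Psi> (\<lambda>t x. 1 / 2 - \<delta> * (4 * (1 + x \<bullet> x) * exp (4 * (T - t)) + 1 / t\<^sup>2))
     (\<lambda>t x. - axis i 1 + (2 * \<delta> * exp (4 * (T - t))) *\<^sub>R x)"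
    by (rule C1_test_function_add_penalty[OF C1_test_function_affine])
  have "\<forall>\<^sub>F (s, y) in nhds (t0, x0). \<phi> s y - ?\<Psi> s y \<le> \<phi> t0 x0 - ?\<Psi> t0 x0"
    by (rule eventually_interior[OF t0]) (use max in \<open>auto simp: f_def\<close>)
  moreover have "HJ_viscosity_subsolution T \<phi>" using sol by (simp add: HJ_Lipschitz_viscosity_solution_def)
  ultimately have le: "- (1 / 2 - \<delta> * (4 * (1 + x0 \<bullet> x0) * ?E + 1 / t0\<^sup>2)) + 1 / 2 * (norm ?G)\<^sup>2 \<le> 0"
    using test t0 unfolding HJ_viscosity_subsolution_def by blast
  define m where "m = \<delta> * ?E"
  have m: "m > 0" using \<delta> by (simp add: m_def)
  have G: "?G = (2 * m) *\<^sub>R x0 - axis i 1" by (simp add: m_def)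
  have N: "(norm ?G)\<^sup>2 = 1 - 4 * (m * x0 $ i) + (2 * m)\<^sup>2 * (x0 \<bullet> x0)"
    unfolding G power2_norm_eq_inner
    by (simp add: inner_diff_left inner_diff_right inner_axis inner_axis' power2_eq_square algebra_simps)
  have q: "(2 * m)\<^sup>2 * (x0 \<bullet> x0) \<ge> 0" by simp
  have "1 / t0\<^sup>2 > 0" using t0 by simp
  hence d: "\<delta> * (1 / t0\<^sup>2) > 0" using \<delta> by (rule mult_pos_pos[rotated])
  have "x0 $ i \<le> norm x0" using component_le_norm_cart[of x0 i] by linarith
  moreover have "2 * norm x0 \<le> 1 + x0 \<bullet> x0"
    using zero_le_power2[of "norm x0 - 1"] by (simp add: power2_diff power2_norm_eq_inner)
  moreover have "x0 \<bullet> x0 \<ge> 0" by simp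
  ultimately have "4 * (1 + x0 \<bullet> x0) - 2 * x0 $ i \<ge> 0" by argo
  hence "m * (4 * (1 + x0 \<bullet> x0) - 2 * x0 $ i) \<ge> 0" using m by simp
  hence p: "4 * m + 4 * (m * (x0 \<bullet> x0)) - 2 * (m * x0 $ i) \<ge> 0" by (simp add: algebra_simps)
  have "- (1 / 2 - \<delta> * (4 * (1 + x0 \<bullet> x0) * ?E + 1 / t0\<^sup>2)) =
      - (1 / 2) + 4 * m + 4 * (m * (x0 \<bullet> x0)) + \<delta> * (1 / t0\<^sup>2)"
    by (simp add: m_def algebra_simps)
  with le N q d p show False by argo
qed

text \<open>Mirror image, with a strict subsolution tested against the supersolution property. Now
  the quadratic term of the squared gradient has the wrong sign.\<close>

lemma viscosity_lower:
  assumes t: "t \<in> {0<..T}" and \<delta>: "\<delta> > 0" "\<delta> \<le> exp (- 4 * T)"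
  shows "\<phi> t x \<ge> - sqrt (\<delta>\<^sup>2 + x \<bullet> x) - (T - t) / 2 - \<delta> * penalty T t x"
proof (rule ccontr)
  let ?\<Psi> = "\<lambda>t x. - sqrt (\<delta>\<^sup>2 + x \<bullet> x) - (T - t) / 2 + (- \<delta>) * penalty T t x"
  define f where "f = (\<lambda>p. ?\<Psi> (fst p) (snd p) - \<phi> (fst p) (snd p))"
  assume "\<not> ?thesis"
  hence start: "f (t, x) > 0" by (simp add: f_def)
  obtain K where K: "K > 0" "\<And>t x. t \<in> {0<..T} \<Longrightarrow> \<bar>\<phi> t x\<bar> + norm x + T \<le> K * (1 + norm x)"
    using viscosity_growth by blast
  have sq: "sqrt (\<delta>\<^sup>2 + y \<bullet> y) \<ge> norm y" for y :: "real ^ 'n"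
    by (simp add: norm_eq_sqrt_inner)
  have cont: "continuous_on ({0<..T} \<times> UNIV) f"
    unfolding f_def penalty_def by (auto intro!: continuous_intros viscosity_continuous)
  have bound: "f (s, y) \<le> K * (1 + norm y) - \<delta> * (norm y)\<^sup>2 - \<delta> / s" if "s \<in> {0<..T}" for s y
  proof -
    have s: "0 < s" "s \<le> T" using that by auto
    have arith: "- b - (T - s) / 2 + - P - a \<le> Q - R - U"
      if "A + n + T \<le> Q" "R + U \<le> P" "n \<le> b" "0 \<le> n" "- a \<le> A" for a b n A P Q R U :: real
      using that s by argo
    show ?thesis unfolding f_def fst_conv snd_conv minus_mult_left[symmetric]
      by (rule arith[OF K(2)[OF that] penalty_ge[OF that \<delta>(1)] sq norm_ge_zero abs_ge_minus_self])
  qed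
  have final: "f (T, y) \<le> 0" for y
  proof -
    have "\<phi> T y = g y" using sol by (simp add: HJ_Lipschitz_viscosity_solution_def)
    moreover have "\<delta> * penalty T T y \<ge> 0" using \<delta> T by (simp add: penalty_def)
    ultimately show ?thesis using g_lower[of y] sq[of y] by (simp add: f_def)
  qed
  obtain t0 x0 where t0: "t0 \<in> {0<..<T}" and max: "\<And>s y. s \<in> {0<..T} \<Longrightarrow> f (s, y) \<le> f (t0, x0)"
    using penalized_max_interior[OF cont \<delta>(1) K(1) bound final t start] by blast
  define E where "E = exp (4 * (T - t0))"
  define c where "c = 1 / sqrt (\<delta>\<^sup>2 + x0 \<bullet> x0)"
  define n where "n = norm x0"
  let ?G = "- (1 / sqrt (\<delta>\<^sup>2 + x0 \<bullet> x0)) *\<^sub>R x0 + (2 * (- \<delta>) * exp (4 * (T - t0))) *\<^sub>R x0"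
  have test: "C1_test_function T ?\<Psi> (\<lambda>t x. 1 / 2 - (- \<delta>) * (4 * (1 + x \<bullet> x) * exp (4 * (T - t)) + 1 / t\<^sup>2))
     (\<lambda>t x. - (1 / sqrt (\<delta>\<^sup>2 + x \<bullet> x)) *\<^sub>R x + (2 * (- \<delta>) * exp (4 * (T - t))) *\<^sub>R x)"
    by (rule C1_test_function_add_penalty[OF C1_test_function_smoothed_norm[OF \<delta>(1)]])
  have "\<phi> s y - ?\<Psi> s y \<ge> \<phi> t0 x0 - ?\<Psi> t0 x0" if "s \<in> {0<..T}" for s y
    using max[OF that, of y] unfolding f_def fst_conv snd_conv by argo
  hence "\<forall>\<^sub>F (s, y) in nhds (t0, x0). \<phi> s y - ?\<Psi> s y \<ge> \<phi> t0 x0 - ?\<Psi> t0 x0"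
    by (rule eventually_interior[OF t0])
  moreover have "HJ_viscosity_supersolution T \<phi>" using sol by (simp add: HJ_Lipschitz_viscosity_solution_def)
  ultimately have ge: "- (1 / 2 - (- \<delta>) * (4 * (1 + x0 \<bullet> x0) * exp (4 * (T - t0)) + 1 / t0\<^sup>2)) + 1 / 2 * (norm ?G)\<^sup>2 \<ge> 0"
    using test t0 unfolding HJ_viscosity_supersolution_def by blast
  have E0: "E > 0" and n0: "n \<ge> 0" by (auto simp: E_def n_def)
  have xx: "x0 \<bullet> x0 = n\<^sup>2" by (simp add: n_def power2_norm_eq_inner)
  have pos: "\<delta>\<^sup>2 + x0 \<bullet> x0 > 0" using \<delta> by (intro add_pos_nonneg) auto
  have c0: "c \<ge> 0" unfolding c_def by simp
  have cn: "c * n \<le> 1" using sq[of x0] pos by (simp add: c_def n_def field_simps)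
  \<comment> \<open>The smallness of \<delta> enters here: with m = \<delta> E <= 1, the quadratic
    term m^2 n^2 is at most m n^2, which the rate 4 can absorb.\<close>
  have dE: "\<delta> * E \<le> 1"
  proof -
    have "\<delta> * E \<le> exp (- 4 * T) * exp (4 * (T - t0))" unfolding E_def using \<delta> by (intro mult_right_mono) auto
    also have "\<dots> \<le> 1" using t0 by (simp add: exp_add[symmetric])
    finally show ?thesis .
  qed
  define m where "m = \<delta> * E"
  have m: "m > 0" "m \<le> 1" using dE E0 \<delta> by (auto simp: m_def)
  have "?G = - (c + 2 * m) *\<^sub>R x0" by (simp add: c_def m_def E_def algebra_simps)
  hence "norm ?G = (c + 2 * m) * n" using c0 m by (simp add: n_def)
  also have "\<dots> \<le> 1 + 2 * m * n" using cn by (simp add: algebra_simps)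
  finally have "(norm ?G)\<^sup>2 \<le> (1 + 2 * m * n)\<^sup>2" by (intro power_mono) auto
  also have "\<dots> = 1 + 4 * m * n + 4 * (m * m) * n\<^sup>2" by (simp add: power2_eq_square algebra_simps)
  also have "\<dots> \<le> 1 + 4 * m * n + 4 * (m * 1) * n\<^sup>2" using m by (intro add_left_mono mult_right_mono mult_left_mono) auto
  finally have G: "(norm ?G)\<^sup>2 \<le> 1 + 4 * m * n + 4 * m * n\<^sup>2" by simp
  have "1 / t0\<^sup>2 > 0" using t0 by simp
  hence d: "\<delta> * (1 / t0\<^sup>2) > 0" using \<delta>(1) by (rule mult_pos_pos[rotated])
  have "2 * n \<le> 1 + n\<^sup>2" using zero_le_power2[of "n - 1"] by (simp add: power2_diff)
  moreover have "n\<^sup>2 \<ge> 0" by simp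
  ultimately have "4 * (1 + n\<^sup>2) - 2 * n - 2 * n\<^sup>2 \<ge> 0" by argo
  hence "m * (4 * (1 + n\<^sup>2) - 2 * n - 2 * n\<^sup>2) \<ge> 0" using m by simp
  hence p: "4 * m + 4 * m * n\<^sup>2 - 2 * m * n - 2 * m * n\<^sup>2 \<ge> 0" by (simp add: algebra_simps)
  have "- (1 / 2 - (- \<delta>) * (4 * (1 + x0 \<bullet> x0) * exp (4 * (T - t0)) + 1 / t0\<^sup>2)) =
      - (1 / 2) - (4 * m + 4 * m * n\<^sup>2) - \<delta> * (1 / t0\<^sup>2)"
    unfolding xx E_def[symmetric] m_def by (simp add: algebra_simps)
  with ge G d p show False by argo
qed

lemma viscosity_solution_at_origin:
  assumes "t \<in> {0..T}"
  shows "\<phi> t 0 = - ((T - t) / 2)"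
proof -
  have pos: "\<phi> s 0 = - ((T - s) / 2)" if s: "s \<in> {0<..T}" for s
  proof (rule antisym)
    let ?A = "penalty T s (0 :: real ^ 'n)"
    have "((\<lambda>\<delta>. \<delta> * ?A - (T - s) / 2) \<longlongrightarrow> 0 * ?A - (T - s) / 2) (at_right 0)"
      by (intro tendsto_intros)
    moreover have "\<forall>\<^sub>F \<delta> in at_right 0. \<phi> s 0 \<le> \<delta> * ?A - (T - s) / 2"
      using eventually_at_right_less[of 0]
      by eventually_elim (use viscosity_upper[OF s, of _ 0] in auto)
    ultimately show "\<phi> s 0 \<le> - ((T - s) / 2)"
      using tendsto_lowerbound[of _ _ "at_right (0::real)" "\<phi> s 0"] by auto
    have "((\<lambda>\<delta>. - \<delta> - (T - s) / 2 - \<delta> * ?A) \<longlongrightarrow> - 0 - (T - s) / 2 - 0 * ?A) (at_right 0)"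
      by (intro tendsto_intros)
    moreover have "\<forall>\<^sub>F \<delta> in at_right 0. - \<delta> - (T - s) / 2 - \<delta> * ?A \<le> \<phi> s 0"
    proof -
      have "\<forall>\<^sub>F \<delta> in at_right (0::real). \<delta> \<in> {0<..<exp (- 4 * T)}"
        by (rule eventually_at_right_real) simp
      thus ?thesis by eventually_elim (use viscosity_lower[OF s, of _ 0] in auto)
    qed
    ultimately show "- ((T - s) / 2) \<le> \<phi> s 0"
      using tendsto_upperbound[of _ _ "at_right (0::real)" "\<phi> s 0"] by auto
  qed
  show ?thesis
  \<comment> \<open>The penalty contains 1 / t, so the bounds say nothing at time 0; that value
    follows by continuity from the right.\<close>
  proof (cases "t = 0")
    case False
    thus ?thesis using pos assms by simp
  next
    case True
    from sol obtain L where "L-lipschitz_on ({0..T} \<times> UNIV) (\<lambda>(t, x). \<phi> t x)"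
      by (auto simp: HJ_Lipschitz_viscosity_solution_def)
    hence "continuous_on ({0..T} \<times> UNIV) (\<lambda>(t, x). \<phi> t x)" by (rule lipschitz_on_continuous_on)
    hence "continuous_on {0..T} (\<lambda>t. \<phi> t 0)"
      using continuous_on_compose2[of "{0..T} \<times> UNIV" "\<lambda>(t, x). \<phi> t x" "{0..T}" "\<lambda>t. (t, 0)"]
      by (force intro: continuous_intros)
    hence "((\<lambda>t. \<phi> t 0) \<longlongrightarrow> \<phi> 0 0) (at_right 0)"
      using T by (rule continuous_on_Icc_at_rightD)
    moreover have "((\<lambda>t. - ((T - t) / 2)) \<longlongrightarrow> - ((T - 0) / 2)) (at_right 0)"
      by (intro tendsto_intros) auto
    moreover have "\<forall>\<^sub>F s in at_right 0. - ((T - s) / 2) = \<phi> s 0"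
    proof -
      have "\<forall>\<^sub>F s in at_right (0::real). s \<in> {0<..<T}" using T by (rule eventually_at_right_real)
      thus ?thesis by eventually_elim (use pos in auto)
    qed
    ultimately have "\<phi> 0 0 = - ((T - 0) / 2)"
      by (metis Lim_transform_eventually tendsto_unique trivial_limit_at_right_real)
    thus ?thesis using True by simp
  qed
qed

end

section \<open>Small viscosity expansion\<close>

theorem proposition3p4:
  fixes k :: nat and T t :: real
    and \<phi> :: "real \<Rightarrow> real \<Rightarrow> real ^ 'n::{finite,linorder} \<Rightarrow> real"
    and \<phi>0 :: "real \<Rightarrow> real ^ 'n::{finite,linorder} \<Rightarrow> real"
  assumes "1 \<le> k" "k \<le> CARD('n)"
    and "T > 0"
    and "\<And>\<epsilon>. \<epsilon> > 0 \<Longrightarrow>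
           viscous_HJ_classical_solution \<epsilon> T (\<lambda>x. - norm (proj_first k x)) (\<phi> \<epsilon>)"
    and "HJ_Lipschitz_viscosity_solution T (\<lambda>x. - norm (proj_first k x)) \<phi>0"
    and "t \<in> {0..<T}"
  shows "(\<lambda>\<epsilon>. \<phi> \<epsilon> t 0 -
            (\<phi>0 t 0 + (real k - 1) / 2 * \<epsilon> * ln \<epsilon> - (real k - 1) / 2 * \<epsilon> * ln (T - t)
             - \<epsilon> * ln (real k * sqrt pi / (2 powr ((real k - 1) / 2) * Gamma (real k / 2 + 1)))))
         \<in> o[at_right 0](\<lambda>\<epsilon>. \<epsilon>)"
proof -
  let ?\<alpha> = "(real k - 1) / 2"
  let ?c = "real k * sqrt pi / (2 powr ?\<alpha> * Gamma (real k / 2 + 1))"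
  define \<tau> where "\<tau> = T - t"
  define main where "main = (\<lambda>s. ?c * s powr ?\<alpha> * exp (s / 2))"
  define u where "u = (\<lambda>\<epsilon>. exp (- \<phi> \<epsilon> t 0 / \<epsilon>))"
  have \<tau>: "\<tau> > 0" using assms(6) by (simp add: \<tau>_def)
  have c: "?c > 0" using assms(1) by (auto intro!: divide_pos_pos mult_pos_pos Gamma_real_pos)
  have \<phi>0: "\<phi>0 t 0 = - (\<tau> / 2)"
  proof -
    \<comment> \<open>The least index has rank 0 < k, so the projection keeps this coordinate for
      every admissible k, and -|P x| <= -x_i.\<close>
    define i :: 'n where "i = Min UNIV"
    have empty: "{j. j < i} = {}" unfolding i_def by (auto simp: not_less)
    have "proj_first k x $ i = x $ i" for x :: "(real, 'n) vec"
      using assms(1) by (simp add: proj_first_def empty)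
    hence "- norm (proj_first k x) \<le> - x $ i" for x :: "(real, 'n) vec"
      using component_le_norm_cart[of "proj_first k x" i] by (simp add: abs_le_iff)
    thus ?thesis
      unfolding \<tau>_def using assms(6) norm_proj_first_le
      by (intro viscosity_solution_at_origin[OF assms(5,3)]) auto
  qed
  have s_lim: "filterlim (\<lambda>\<epsilon>. \<tau> / \<epsilon>) at_top (at_right 0)"
    using \<tau> by real_asymp
  \<comment> \<open>Makes the deficit 1 in the lower bound negligible. The exponent is nonnegative
    because k >= 1; for k = 1 divergence comes from the exponential alone.\<close>
  have main_lim: "filterlim main at_top at_top"
  proof -
    have "?\<alpha> \<ge> 0" using assms(1) by simp
    thus ?thesis unfolding main_def using c by real_asymp
  qed
  have F: "((\<lambda>s. 2 * cosh_heat_series k s / main s) \<longlongrightarrow> 1) at_top"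
    unfolding main_def by (rule cosh_heat_series_asymp[OF assms(1)])
  have "((\<lambda>s. 2 * cosh_heat_series k s / main s - 1 / main s) \<longlongrightarrow> 1 - 0) at_top"
    by (intro tendsto_diff F tendsto_divide_0[OF tendsto_const] filterlim_at_top_imp_at_infinity main_lim)
  hence F': "((\<lambda>s. (2 * cosh_heat_series k s - 1) / main s) \<longlongrightarrow> 1) at_top"
    by (simp add: diff_divide_distrib)
  have main_pos: "main s > 0" if "s > 0" for s
    unfolding main_def using c that by (intro mult_pos_pos) auto
  have t: "t \<in> {0..T}" using assms(6) by auto
  have "((\<lambda>\<epsilon>. u \<epsilon> / main (\<tau> / \<epsilon>)) \<longlongrightarrow> 1) (at_right 0)"
  proof (rule tendsto_sandwich)
    show "((\<lambda>\<epsilon>. (2 * cosh_heat_series k (\<tau> / \<epsilon>) - 1) / main (\<tau> / \<epsilon>)) \<longlongrightarrow> 1) (at_right 0)"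
      using F' s_lim by (rule filterlim_compose)
    show "((\<lambda>\<epsilon>. 2 * cosh_heat_series k (\<tau> / \<epsilon>) / main (\<tau> / \<epsilon>)) \<longlongrightarrow> 1) (at_right 0)"
      using F s_lim by (rule filterlim_compose)
    show "\<forall>\<^sub>F \<epsilon> in at_right 0. (2 * cosh_heat_series k (\<tau> / \<epsilon>) - 1) / main (\<tau> / \<epsilon>) \<le> u \<epsilon> / main (\<tau> / \<epsilon>)"
      using eventually_at_right_less[of 0]
    proof eventually_elim
      case (elim \<epsilon>)
      show ?case
        unfolding u_def \<tau>_def
        using exp_viscous_solution_lower[OF assms(1,2) elim assms(3) assms(4)[OF elim] t]
          main_pos[of "\<tau> / \<epsilon>"] elim \<tau> by (intro divide_right_mono) (auto simp: \<tau>_def)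
    qed
    show "\<forall>\<^sub>F \<epsilon> in at_right 0. u \<epsilon> / main (\<tau> / \<epsilon>) \<le> 2 * cosh_heat_series k (\<tau> / \<epsilon>) / main (\<tau> / \<epsilon>)"
      using eventually_at_right_less[of 0]
    proof eventually_elim
      case (elim \<epsilon>)
      show ?case
        unfolding u_def \<tau>_def
        using exp_viscous_solution_upper[OF assms(1,2) elim assms(3) assms(4)[OF elim] t]
          main_pos[of "\<tau> / \<epsilon>"] elim \<tau> by (intro divide_right_mono) (auto simp: \<tau>_def)
    qed
  qed
  from tendsto_minus[OF tendsto_ln[OF this]]
  have lim: "((\<lambda>\<epsilon>. - ln (u \<epsilon> / main (\<tau> / \<epsilon>))) \<longlongrightarrow> 0) (at_right 0)" by simp
  \<comment> \<open>The remainder divided by \<epsilon> is exactly minus the logarithm of a quotient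
    tending to 1, so the o(\<epsilon>) claim is equivalent to the limit above.\<close>
  have eq: "- ln (u \<epsilon> / main (\<tau> / \<epsilon>)) = (\<phi> \<epsilon> t 0 - (\<phi>0 t 0 + ?\<alpha> * \<epsilon> * ln \<epsilon> - ?\<alpha> * \<epsilon> * ln (T - t) - \<epsilon> * ln ?c)) / \<epsilon>"
    if \<epsilon>: "\<epsilon> > 0" for \<epsilon>
  proof -
    have s: "\<tau> / \<epsilon> > 0" using \<tau> \<epsilon> by simp
    have pw: "(\<tau> / \<epsilon>) powr ?\<alpha> > 0" using \<tau> \<epsilon> by simp
    have "ln (main (\<tau> / \<epsilon>)) = ln (?c * (\<tau> / \<epsilon>) powr ?\<alpha>) + \<tau> / \<epsilon> / 2"
      unfolding main_def ln_mult_pos[OF mult_pos_pos[OF c pw] exp_gt_zero] ln_exp ..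
    also have "ln (?c * (\<tau> / \<epsilon>) powr ?\<alpha>) = ln ?c + ?\<alpha> * ln (\<tau> / \<epsilon>)"
      unfolding ln_mult_pos[OF c pw] using s by (simp add: ln_powr)
    also have "ln (\<tau> / \<epsilon>) = ln \<tau> - ln \<epsilon>" using \<tau> \<epsilon> by (rule ln_divide_pos)
    finally have m: "ln (main (\<tau> / \<epsilon>)) = ln ?c + ?\<alpha> * (ln \<tau> - ln \<epsilon>) + \<tau> / \<epsilon> / 2" .
    have l: "ln (u \<epsilon> / main (\<tau> / \<epsilon>)) = - \<phi> \<epsilon> t 0 / \<epsilon> - ln (main (\<tau> / \<epsilon>))"
      using main_pos[OF s] by (subst ln_divide_pos) (auto simp: u_def)
    have alg: "- (- p / \<epsilon> - (C + a * (lt - le) + \<tau> / \<epsilon> / 2)) = (p - (- (\<tau> / 2) + a * \<epsilon> * le - a * \<epsilon> * lt - \<epsilon> * C)) / \<epsilon>"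
      for p C a lt le :: real using \<epsilon> by (simp add: field_simps)
    show ?thesis unfolding l m \<phi>0 \<tau>_def[symmetric] by (rule alg)
  qed
  show ?thesis
  proof (rule smalloI_tendsto)
    show "((\<lambda>\<epsilon>. (\<phi> \<epsilon> t 0 - (\<phi>0 t 0 + ?\<alpha> * \<epsilon> * ln \<epsilon> - ?\<alpha> * \<epsilon> * ln (T - t) - \<epsilon> * ln ?c)) / \<epsilon>) \<longlongrightarrow> 0) (at_right 0)"
      by (rule Lim_transform_eventually[OF lim])
         (use eventually_at_right_less[of 0] in eventually_elim, rule eq)
    show "\<forall>\<^sub>F \<epsilon> in at_right 0. \<epsilon> \<noteq> (0 :: real)"
      using eventually_at_right_less[of "0 :: real"] by eventually_elim simp
  qed
qed

end
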